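(* A minimal counterexample to the Conforti–Cornuéjols conjecture cannot be unmixed. Precisely: let $\mathcal H$ be a simple hypergraph on vertices $x_1,\dots,x_d$ and let $I(\mathcal H) \subseteq k[x_1,\dots,x_d]$ be its edge ideal, $k$ a field. If $\mathcal H$ has the packing property, $\mathcal H$ does not have the max-flow min-cut (MFMC) property, and no proper minor of $\mathcal H$ has the packing property while failing the MFMC property, then $I(\mathcal H)$ is not unmixed.
   Context: A simple hypergraph $\mathcal H$ (clutter) on a finite vertex set $\{x_1,\dots,x_d\}$ is a family $E(\mathcal H)$ of nonempty subsets (edges) with no non-trivial containments. Its edge ideal is $I(\mathcal H) = \langle \prod_{x\in E} x \mid E \in E(\mathcal H)\rangle$. An ideal is unmixed if all of its associated primes have the same height. Minors: the deletion of a vertex $x$ removes $x$ from the vertex set and deletes all edges containing $x$ (setting $x=0$ in the generators of $I(\mathcal H)$); the contraction of $x$ removes $x$ from the vertex set and from all edges containing it, keeping only the inclusion-minimal resulting sets (setting $x=1$ in the generators of $I(\mathcal H)$). A minor is obtained by a sequence of deletions and contractions; it is proper if at least one such operation is performed. Packing property: $\alpha_0(\mathcal H)$ is the minimum cardinality of a vertex cover (a set of vertices meeting every edge), and $\beta_1(\mathcal H)$ is the maximum number of pairwise disjoint edges. $\mathcal H$ satisfies the König property if $\alpha_0(\mathcal H) = \beta_1(\mathcal H)$, and has the packing property if $\mathcal H$ and all its minors satisfy the König property. MFMC property: let $A$ be the $d \times q$ incidence matrix whose columns are the $0/1$ characteristic vectors of the $q$ edges. $\mathcal H$ has the MFMC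 property if for every nonnegative integral vector $c \in \mathbb Z_{\ge 0}^d$ both sides of the linear programming duality $$\min\{\langle c, x\rangle \mid x\in\mathbb R^d,\ x \ge 0,\ xA \ge \mathbf 1\} = \max\{\langle y, \mathbf 1\rangle \mid y \in\mathbb R^q,\ y \ge 0,\ Ay \le c\}$$ have integral optimal solutions $x$ and $y$. The Conforti–Cornuéjols conjecture asserts that every simple hypergraph with the packing property has the MFMC property. Convention: trivial minors (with no edges, or with the empty set as an edge, i.e. with edge ideal $0$ or the unit ideal) are regarded as having the König and MFMC properties. *)

theory Defs
  imports
    Complex_Main
    "HOL-Algebra.Ideal"
    "HOL-Library.Poly_Mapping"
    "HOL-Library.Extended_Nat"
begin

datatype 'v hypergraph = Hypergraph (verts: "'v set") (edges: "'v set set")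

definition simple_hypergraph :: "'v hypergraph \<Rightarrow> bool" where
  "simple_hypergraph H \<longleftrightarrow>
     finite (verts H) \<and>
     (\<forall>e\<in>edges H. e \<noteq> {} \<and> e \<subseteq> verts H) \<and>
     (\<forall>e\<in>edges H. \<forall>e'\<in>edges H. e \<subseteq> e' \<longrightarrow> e = e')"

definition deletion :: "'v \<Rightarrow> 'v hypergraph \<Rightarrow> 'v hypergraph" where
  "deletion x H = Hypergraph (verts H - {x}) {e \<in> edges H. x \<notin> e}"

definition minimal_sets :: "'v set set \<Rightarrow> 'v set set" where
  "minimal_sets F = {e \<in> F. \<forall>e'\<in>F. \<not> e' \<subset> e}"

definition contraction :: "'v \<Rightarrow> 'v hypergraph \<Rightarrow> 'v hypergraph" where
  "contraction x H =
     Hypergraph (verts H - {x}) (minimal_sets ((\<lambda>e. e - {x}) ` edges H))"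

definition minor_step :: "'v hypergraph \<Rightarrow> 'v hypergraph \<Rightarrow> bool" where
  "minor_step H H' \<longleftrightarrow> (\<exists>x\<in>verts H. H' = deletion x H \<or> H' = contraction x H)"

definition is_minor :: "'v hypergraph \<Rightarrow> 'v hypergraph \<Rightarrow> bool" where
  "is_minor H' H \<longleftrightarrow> minor_step\<^sup>*\<^sup>* H H'"

definition is_proper_minor :: "'v hypergraph \<Rightarrow> 'v hypergraph \<Rightarrow> bool" where
  "is_proper_minor H' H \<longleftrightarrow> minor_step\<^sup>+\<^sup>+ H H'"

text \<open>
  Contracting all vertices of an edge produces the empty set as an edge, so a minor of a simple
  hypergraph need not be simple. The trivial hypergraphs, i.e. those whose edge ideal is zero or
  the unit ideal, have the Koenig and the MFMC property by convention.
\<close>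

definition trivial_hypergraph :: "'v hypergraph \<Rightarrow> bool" where
  "trivial_hypergraph H \<longleftrightarrow> edges H = {} \<or> {} \<in> edges H"

definition vertex_cover :: "'v hypergraph \<Rightarrow> 'v set \<Rightarrow> bool" where
  "vertex_cover H C \<longleftrightarrow> C \<subseteq> verts H \<and> (\<forall>e\<in>edges H. C \<inter> e \<noteq> {})"

text \<open>
  \<open>cover_number\<close> is $\alpha_0$; it is only meaningful if the empty set is not an edge, since
  otherwise there is no vertex cover. \<open>matching_number\<close> is $\beta_1$.
\<close>

definition cover_number :: "'v hypergraph \<Rightarrow> nat" where
  "cover_number H = Min {card C | C. vertex_cover H C}"

definition matching_number :: "'v hypergraph \<Rightarrow> nat" where
  "matching_number H = Max {card M | M. M \<subseteq> edges H \<and> pairwise disjnt M}"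

definition konig :: "'v hypergraph \<Rightarrow> bool" where
  "konig H \<longleftrightarrow> trivial_hypergraph H \<or> cover_number H = matching_number H"

definition packing :: "'v hypergraph \<Rightarrow> bool" where
  "packing H \<longleftrightarrow> (\<forall>H'. is_minor H' H \<longrightarrow> konig H')"

text \<open>
  Vectors in $\mathbb{R}^d$ and $\mathbb{R}^q$ are functions on vertices and on edges, of which
  only the values on \<open>verts H\<close> and \<open>edges H\<close> matter.
\<close>

definition incidence :: "'v \<Rightarrow> 'v set \<Rightarrow> real" where
  "incidence v e = of_bool (v \<in> e)"

definition primal_feasible :: "'v hypergraph \<Rightarrow> ('v \<Rightarrow> real) \<Rightarrow> bool" where
  "primal_feasible H x \<longleftrightarrow>
     (\<forall>v\<in>verts H. 0 \<le> x v) \<and> (\<forall>e\<in>edges H. 1 \<le> (\<Sum>v\<in>verts H. x v * incidence v e))"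

definition primal_value :: "'v hypergraph \<Rightarrow> ('v \<Rightarrow> nat) \<Rightarrow> ('v \<Rightarrow> real) \<Rightarrow> real" where
  "primal_value H c x = (\<Sum>v\<in>verts H. real (c v) * x v)"

definition dual_feasible :: "'v hypergraph \<Rightarrow> ('v \<Rightarrow> nat) \<Rightarrow> ('v set \<Rightarrow> real) \<Rightarrow> bool" where
  "dual_feasible H c y \<longleftrightarrow>
     (\<forall>e\<in>edges H. 0 \<le> y e) \<and> (\<forall>v\<in>verts H. (\<Sum>e\<in>edges H. incidence v e * y e) \<le> real (c v))"

definition dual_value :: "'v hypergraph \<Rightarrow> ('v set \<Rightarrow> real) \<Rightarrow> real" where
  "dual_value H y = (\<Sum>e\<in>edges H. y e)"

definition primal_optimal :: "'v hypergraph \<Rightarrow> ('v \<Rightarrow> nat) \<Rightarrow> ('v \<Rightarrow> real) \<Rightarrow> bool" where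
  "primal_optimal H c x \<longleftrightarrow>
     primal_feasible H x \<and>
     (\<forall>x'. primal_feasible H x' \<longrightarrow> primal_value H c x \<le> primal_value H c x')"

definition dual_optimal :: "'v hypergraph \<Rightarrow> ('v \<Rightarrow> nat) \<Rightarrow> ('v set \<Rightarrow> real) \<Rightarrow> bool" where
  "dual_optimal H c y \<longleftrightarrow>
     dual_feasible H c y \<and>
     (\<forall>y'. dual_feasible H c y' \<longrightarrow> dual_value H y' \<le> dual_value H y)"

definition mfmc :: "'v hypergraph \<Rightarrow> bool" where
  "mfmc H \<longleftrightarrow> trivial_hypergraph H \<or>
     (\<forall>c. (\<exists>x. primal_optimal H c x \<and> (\<forall>v\<in>verts H. x v \<in> \<int>)) \<and>
          (\<exists>y. dual_optimal H c y \<and> (\<forall>e\<in>edges H. y e \<in> \<int>)))"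

text \<open>
  The associated primes of \<open>I\<close> are those of the module $R/I$: the prime ideals of the form
  $(I : f)$.
\<close>

definition assoc_primes :: "('a, 'b) ring_scheme \<Rightarrow> 'a set \<Rightarrow> 'a set set" where
  "assoc_primes R I =
     {P. primeideal P R \<and> (\<exists>f\<in>carrier R. P = {g \<in> carrier R. g \<otimes>\<^bsub>R\<^esub> f \<in> I})}"

definition prime_height :: "('a, 'b) ring_scheme \<Rightarrow> 'a set \<Rightarrow> enat" where
  "prime_height R P = Sup {enat n | n. \<exists>Q :: nat \<Rightarrow> 'a set.
     (\<forall>i\<le>n. primeideal (Q i) R) \<and> (\<forall>i<n. Q i \<subset> Q (Suc i)) \<and> Q n = P}"

definition unmixed :: "('a, 'b) ring_scheme \<Rightarrow> 'a set \<Rightarrow> bool" where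
  "unmixed R I \<longleftrightarrow>
     (\<forall>P\<in>assoc_primes R I. \<forall>Q\<in>assoc_primes R I. prime_height R P = prime_height R Q)"

text \<open>
  A polynomial is a finitely supported map from monomials (exponent vectors) to coefficients.
  \<open>mpoly_ring V\<close> is the ring $k[x_v \mid v \in V]$.
\<close>

type_synonym ('v, 'k) mpoly = "('v \<Rightarrow>\<^sub>0 nat) \<Rightarrow>\<^sub>0 'k"

definition mpoly_ring :: "'v set \<Rightarrow> ('v, 'k::field) mpoly ring" where
  "mpoly_ring V =
     \<lparr>carrier = {p. \<forall>m\<in>Poly_Mapping.keys p. Poly_Mapping.keys m \<subseteq> V}, mult = (*), one = 1, zero = 0, add = (+)\<rparr>"

definition Var :: "'v \<Rightarrow> ('v, 'k::field) mpoly" where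
  "Var v = Poly_Mapping.single (Poly_Mapping.single v 1) 1"

definition edge_ideal :: "'v hypergraph \<Rightarrow> ('v, 'k::field) mpoly set" where
  "edge_ideal H = genideal (mpoly_ring (verts H)) ((\<lambda>e. \<Prod>v\<in>e. Var v) ` edges H)"

lemma mpoly_ring_cring: "cring (mpoly_ring V :: ('v, 'k::field) mpoly ring)"
proof -
  let ?R = "mpoly_ring V :: ('v, 'k) mpoly ring"
  have zero: "0 \<in> carrier ?R" and one: "1 \<in> carrier ?R"
    by (simp_all add: mpoly_ring_def)
  have add: "p + q \<in> carrier ?R" if "p \<in> carrier ?R" "q \<in> carrier ?R" for p q
    using that Poly_Mapping.keys_add[of p q] unfolding mpoly_ring_def by fastforce
  have mult: "p * q \<in> carrier ?R" if p: "p \<in> carrier ?R" and q: "q \<in> carrier ?R" for p q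
  proof -
    have "Poly_Mapping.keys m \<subseteq> V" if m: "m \<in> Poly_Mapping.keys (p * q)" for m
    proof -
      obtain a b where ab: "a \<in> Poly_Mapping.keys p" "b \<in> Poly_Mapping.keys q" "m = a + b"
        using m Poly_Mapping.keys_mult[of p q] by blast
      have "Poly_Mapping.keys a \<subseteq> V" "Poly_Mapping.keys b \<subseteq> V"
        using p q ab(1,2) by (simp_all add: mpoly_ring_def)
      then show ?thesis
        using Poly_Mapping.keys_add[of a b] ab(3) by blast
    qed
    then show ?thesis by (simp add: mpoly_ring_def)
  qed
  have uminus: "- p \<in> carrier ?R" if "p \<in> carrier ?R" for p
    using that by (simp add: mpoly_ring_def)
  have ops: "x \<oplus>\<^bsub>?R\<^esub> y = x + y" "x \<otimes>\<^bsub>?R\<^esub> y = x * y" "\<zero>\<^bsub>?R\<^esub> = 0" "\<one>\<^bsub>?R\<^esub> = 1" for x y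
    by (simp_all add: mpoly_ring_def)
  have "\<exists>q\<in>carrier ?R. q + p = 0" if "p \<in> carrier ?R" for p
    using uminus[OF that] by (intro bexI[of _ "- p"]) simp_all
  then have "abelian_group ?R"
    by (intro abelian_groupI; unfold ops)
       (auto simp: zero intro: add add.assoc add.commute)
  moreover have "comm_monoid ?R"
    by (intro comm_monoidI; unfold ops)
       (auto simp: one intro: mult mult.assoc mult.commute)
  ultimately show ?thesis
    by (rule cringI) (simp add: ops distrib_right)
qed

end

(* For a minimal vertex cover C, the prime generated by the variables in C is associated to the edge
   ideal and has height card C, so unmixedness makes all minimal covers equally large. By the Koenig
   property their common size h is attained by a matching M. Subtracting the characteristic vector of
   the union of M from a weight c > 0 then lowers the weight of each minimal cover by at most h and
   frees capacity for packing M, so the min-max equality passes from the smaller weight to c. If some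
   c x = 0, the equality comes from the deletion of x, which has the MFMC property by minimality. *)

theory Submission
  imports Defs
begin

section \<open>Minimal covers and the min-max equality\<close>

text \<open>\<open>mfmc\<close> speaks of integral optima among all real solutions, whereas a
  descent on the weight needs one equality between the weight of a cover and the value of an
  integral packing. \<open>minmax\<close> is this equality; it asks only for \<open>\<le>\<close>,
  since weak duality gives the reverse. The deletions come with \<open>mfmc\<close> and have to be
  brought back to \<open>minmax\<close>. This is a strong duality statement, obtained by a separate
  descent on the weight.

  The obstacle on the algebraic side is that \<open>prime_height\<close> admits chains of arbitrary
  primes, not only of primes generated by variables. Its upper bound is the dimension bound for a
  polynomial ring. This rests on counting monomials: more than n polynomials in n variables are
  algebraically dependent, while elements taken from the successive gaps of a prime chain satisfy no
  nontrivial relation.\<close>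

definition minmax :: "'v hypergraph \<Rightarrow> ('v \<Rightarrow> nat) \<Rightarrow> bool" where
  "minmax H c \<longleftrightarrow> (\<exists>B y. vertex_cover H B \<and> dual_feasible H c y \<and>
     (\<forall>e\<in>edges H. y e \<in> \<int>) \<and> real (sum c B) \<le> dual_value H y)"

lemma minmaxI:
  assumes "vertex_cover H B" "dual_feasible H c y" "\<And>e. e \<in> edges H \<Longrightarrow> y e \<in> \<int>"
    and "real (sum c B) \<le> dual_value H y"
  shows "minmax H c"
  using assms unfolding minmax_def by blast

lemma finite_edges: "simple_hypergraph H \<Longrightarrow> finite (edges H)"
  unfolding simple_hypergraph_def by (meson PowI finite_Pow_iff finite_subset subsetI)

lemma sum_incidence_verts:
  assumes "simple_hypergraph H" "e \<in> edges H"
  shows "(\<Sum>v\<in>verts H. x v * incidence v e) = sum x e"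
proof -
  have fe: "finite (verts H)" "e \<subseteq> verts H"
    using assms by (auto simp: simple_hypergraph_def)
  have "(\<Sum>v\<in>verts H. x v * incidence v e) = (\<Sum>v\<in>verts H. if v \<in> e then x v else 0)"
    by (intro sum.cong) (auto simp: incidence_def)
  also have "\<dots> = sum x e"
    using fe by (simp add: sum.inter_restrict[symmetric] Int_absorb1)
  finally show ?thesis .
qed

lemma weak_duality:
  assumes "primal_feasible H x" "dual_feasible H c y"
  shows "dual_value H y \<le> primal_value H c x"
proof -
  have "dual_value H y \<le> (\<Sum>e\<in>edges H. y e * (\<Sum>v\<in>verts H. x v * incidence v e))"
    unfolding dual_value_def using assms
    by (intro sum_mono) (auto simp: primal_feasible_def dual_feasible_def mult_le_cancel_left1 not_less)
  also have "\<dots> = (\<Sum>v\<in>verts H. x v * (\<Sum>e\<in>edges H. incidence v e * y e))"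
    by (simp add: sum_distrib_left sum.swap[of _ "edges H"] mult_ac)
  also have "\<dots> \<le> (\<Sum>v\<in>verts H. x v * real (c v))"
    using assms by (intro sum_mono mult_left_mono) (auto simp: primal_feasible_def dual_feasible_def)
  finally show ?thesis by (simp add: primal_value_def mult.commute)
qed

lemma primal_feasible_cover:
  assumes "simple_hypergraph H" "vertex_cover H B"
  shows "primal_feasible H (\<lambda>v. of_bool (v \<in> B))"
  unfolding primal_feasible_def
proof (intro conjI ballI)
  fix e assume e: "e \<in> edges H"
  then have fe: "finite e"
    using assms by (auto simp: simple_hypergraph_def intro: finite_subset)
  obtain v where "v \<in> B" "v \<in> e" using assms e by (auto simp: vertex_cover_def)
  then have "(1::real) \<le> (\<Sum>v\<in>e. of_bool (v \<in> B))"
    using fe member_le_sum[of v e "\<lambda>v. of_bool (v \<in> B) :: real"] by auto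
  then show "(1::real) \<le> (\<Sum>v\<in>verts H. of_bool (v \<in> B) * incidence v e)"
    using sum_incidence_verts[OF assms(1) e] by metis
qed auto

lemma primal_value_cover:
  assumes "finite (verts H)" "B \<subseteq> verts H"
  shows "primal_value H c (\<lambda>v. of_bool (v \<in> B)) = real (sum c B)"
proof -
  have "primal_value H c (\<lambda>v. of_bool (v \<in> B)) = (\<Sum>v\<in>verts H. if v \<in> B then real (c v) else 0)"
    unfolding primal_value_def by (intro sum.cong) auto
  also have "\<dots> = real (sum c B)"
    using assms by (simp add: sum.inter_restrict[symmetric] Int_absorb1)
  finally show ?thesis .
qed

text \<open>Weak duality squeezes the values of the indicator of the cover and of the packing
  together, so each certifies the optimality of the other.\<close>

lemma minmax_imp_mfmc:
  assumes "simple_hypergraph H" and mm: "\<And>c. minmax H c"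
  shows "mfmc H"
  unfolding mfmc_def
proof (intro disjI2 allI)
  fix c
  obtain B y where By: "vertex_cover H B" "dual_feasible H c y" "\<forall>e\<in>edges H. y e \<in> \<int>"
      "real (sum c B) \<le> dual_value H y"
    using mm[of c] unfolding minmax_def by blast
  let ?x = "\<lambda>v. of_bool (v \<in> B) :: real"
  have fx: "primal_feasible H ?x" using assms(1) By(1) by (rule primal_feasible_cover)
  have le: "primal_value H c ?x \<le> dual_value H y"
    using By assms(1) primal_value_cover[of H B c] by (simp add: vertex_cover_def simple_hypergraph_def)
  have "primal_optimal H c ?x"
    unfolding primal_optimal_def using fx le weak_duality[OF _ By(2)] order_trans by blast
  moreover have "dual_optimal H c y"
    unfolding dual_optimal_def using By(2) le weak_duality[OF fx, of c] order_trans by blast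
  ultimately show "(\<exists>x. primal_optimal H c x \<and> (\<forall>v\<in>verts H. x v \<in> \<int>)) \<and>
        (\<exists>y. dual_optimal H c y \<and> (\<forall>e\<in>edges H. y e \<in> \<int>))"
    using By(3) by (intro conjI exI[of _ ?x] exI[of _ y]) auto
qed

text \<open>Strong duality is not needed. In a minimal counterexample \<open>c\<close>, decreasing \<open>c\<close> at a vertex of its
  support \<open>S\<close> leaves the dual optimum unchanged; the average over \<open>S\<close> of these dual solutions has
  room for a further \<open>1 / card S\<close> on any edge inside \<open>S\<close>, which beats the optimum for \<open>c\<close>.\<close>

lemma dual_integral_imp_minmax:
  assumes simple: "simple_hypergraph H"
    and opt: "\<And>c. \<exists>y. dual_optimal H c y \<and> (\<forall>e\<in>edges H. y e \<in> \<int>)"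
  shows "minmax H c"
proof (induction "sum c (verts H)" arbitrary: c rule: less_induct)
  case less
  have fV: "finite (verts H)" and sub: "\<And>e. e \<in> edges H \<Longrightarrow> e \<noteq> {} \<and> e \<subseteq> verts H"
    using simple by (auto simp: simple_hypergraph_def)
  have fE: "finite (edges H)" using simple by (rule finite_edges)
  define S where "S = {v \<in> verts H. c v > 0}"
  have fS: "finite S" using fV by (simp add: S_def)
  show ?case
  proof (cases "\<exists>e\<in>edges H. e \<subseteq> S")
    \<comment> \<open>No edge lies inside the support of \<open>c\<close>, so the vertices of weight
      0 form a cover at cost 0.\<close>
    case False
    show ?thesis
    proof (rule minmaxI)
      show "vertex_cover H (verts H - S)"
        using False sub by (fastforce simp: vertex_cover_def)
      show "dual_feasible H c (\<lambda>_. 0)" by (simp add: dual_feasible_def)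
      show "real (sum c (verts H - S)) \<le> dual_value H (\<lambda>_. 0)"
        by (simp add: S_def dual_value_def)
    qed auto
  next
    case True
    then obtain e where e: "e \<in> edges H" "e \<subseteq> S" by blast
    have S0: "S \<noteq> {}" "card S > 0" using e sub[of e] fS by (auto simp: card_gt_0_iff)
    define d where "d v = c(v := c v - 1)" for v
    have dless: "sum (d v) (verts H) < sum c (verts H)" if "v \<in> S" for v
      using that fV by (intro sum_strict_mono_ex1) (auto simp: d_def S_def)
    have "\<forall>v\<in>S. \<exists>B y. vertex_cover H B \<and> dual_feasible H (d v) y \<and>
        (\<forall>e\<in>edges H. y e \<in> \<int>) \<and> real (sum (d v) B) \<le> dual_value H y"
      using less[OF dless] unfolding minmax_def by blast
    then obtain B y where By: "\<And>v. v \<in> S \<Longrightarrow> vertex_cover H (B v)"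
        "\<And>v. v \<in> S \<Longrightarrow> dual_feasible H (d v) (y v)"
        "\<And>v e. v \<in> S \<Longrightarrow> e \<in> edges H \<Longrightarrow> y v e \<in> \<int>"
        "\<And>v. v \<in> S \<Longrightarrow> real (sum (d v) (B v)) \<le> dual_value H (y v)"
      by metis
    obtain z where z: "dual_optimal H c z" "\<And>e. e \<in> edges H \<Longrightarrow> z e \<in> \<int>"
      using opt by metis
    have fz: "dual_feasible H c z" using z by (simp add: dual_optimal_def)
    show ?thesis
    proof (cases "\<exists>v\<in>S. dual_value H (y v) < dual_value H z")
      case True
      then obtain v where v: "v \<in> S" "dual_value H (y v) < dual_value H z" by blast
      \<comment> \<open>Both values are integers, so a strict gap is at least 1. This pays for
        raising the weight at \<open>v\<close> by 1 on the cover \<open>B v\<close>.\<close>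
      have "dual_value H (y v) \<in> \<int>" "dual_value H z \<in> \<int>"
        unfolding dual_value_def using By(3)[OF v(1)] z(2) by (auto intro: Ints_sum)
      then have v2: "dual_value H (y v) + 1 \<le> dual_value H z"
        using v(2) by (auto elim!: Ints_cases)
      have Bv: "finite (B v)" using By(1)[OF v(1)] fV by (auto simp: vertex_cover_def intro: finite_subset)
      have "sum c (B v) \<le> (\<Sum>u\<in>B v. d v u + (if u = v then 1 else 0))"
        by (intro sum_mono) (auto simp: d_def)
      also have "\<dots> \<le> sum (d v) (B v) + 1"
        using Bv by (simp add: sum.distrib)
      finally have "real (sum c (B v)) \<le> real (sum (d v) (B v)) + 1" by linarith
      then have "real (sum c (B v)) \<le> dual_value H z" using By(4)[OF v(1)] v2 by linarith
      then show ?thesis using By(1)[OF v(1)] fz z(2) by (intro minmaxI)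
    next
      case False
      let ?n = "real (card S)"
      define w where "w e' = ((\<Sum>v\<in>S. y v e') + of_bool (e' = e)) / ?n" for e'
      have "dual_feasible H c w"
        unfolding dual_feasible_def
      proof (intro conjI ballI)
        fix e' assume "e' \<in> edges H"
        then show "0 \<le> w e'" using By(2) unfolding w_def dual_feasible_def
          by (intro divide_nonneg_nonneg add_nonneg_nonneg sum_nonneg) auto
      next
        fix u assume u: "u \<in> verts H"
        have "(\<Sum>e'\<in>edges H. incidence u e' * w e') * ?n
            = (\<Sum>e'\<in>edges H. incidence u e' * ((\<Sum>v\<in>S. y v e') + of_bool (e' = e)))"
          unfolding w_def sum_distrib_right using S0 by (intro sum.cong) auto
        also have "\<dots> = (\<Sum>v\<in>S. \<Sum>e'\<in>edges H. incidence u e' * y v e') + incidence u e"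
          using fE e(1) by (simp add: distrib_left sum.distrib sum_distrib_left sum.swap[of _ S])
        also have "\<dots> \<le> (\<Sum>v\<in>S. real (d v u)) + incidence u e"
          using By(2) u by (intro add_right_mono sum_mono) (auto simp: dual_feasible_def)
        \<comment> \<open>A vertex \<open>u\<close> of \<open>S\<close> loses one unit in exactly
          one summand, that of \<open>v = u\<close>. This unit pays for the extra edge
          \<open>e\<close>, all of whose vertices lie in \<open>S\<close>.\<close>
        also have "\<dots> \<le> (\<Sum>v\<in>S. real (c u) - of_bool (u = v)) + of_bool (u \<in> S)"
          using e(2) by (intro add_mono sum_mono) (auto simp: d_def S_def incidence_def of_bool_def of_nat_diff)
        also have "\<dots> = ?n * real (c u)"
          using fS by (simp add: sum_subtractf of_bool_def)
        finally show "(\<Sum>e'\<in>edges H. incidence u e' * w e') \<le> real (c u)"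
          using S0 by (simp add: mult.commute)
      qed
      then have "dual_value H w * ?n \<le> dual_value H z * ?n"
        using z(1) by (intro mult_right_mono) (auto simp: dual_optimal_def)
      moreover have "dual_value H w * ?n = (\<Sum>e'\<in>edges H. (\<Sum>v\<in>S. y v e') + of_bool (e' = e))"
        unfolding w_def dual_value_def sum_distrib_right using S0 by (intro sum.cong) auto
      then have "dual_value H w * ?n = (\<Sum>v\<in>S. dual_value H (y v)) + 1"
        using fE e(1) by (simp add: sum.distrib dual_value_def sum.swap[of _ S])
      moreover have "(\<Sum>v\<in>S. dual_value H z) \<le> (\<Sum>v\<in>S. dual_value H (y v))"
        using False by (intro sum_mono) auto
      ultimately show ?thesis by (simp add: mult.commute)
    qed
  qed
qed

text \<open>Without edges \<open>mfmc\<close> holds by convention and yields no dual optimum, so the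
  empty cover and the zero packing serve directly. With edges, simplicity excludes the empty edge
  and the convention does not apply.\<close>

lemma mfmc_imp_minmax:
  assumes "simple_hypergraph H" "mfmc H"
  shows "minmax H c"
proof (cases "edges H = {}")
  case True
  then show ?thesis
    by (intro minmaxI[of _ "{}" _ "\<lambda>_. 0"]) (auto simp: vertex_cover_def dual_feasible_def dual_value_def)
next
  case False
  then have "\<not> trivial_hypergraph H"
    using assms(1) by (auto simp: trivial_hypergraph_def simple_hypergraph_def)
  then show ?thesis
    using assms by (intro dual_integral_imp_minmax) (auto simp: mfmc_def)
qed

section \<open>Descent on the weight: deletions, minimal covers and matchings\<close>

lemma simple_deletion: "simple_hypergraph H \<Longrightarrow> simple_hypergraph (deletion x H)"
  by (auto simp: simple_hypergraph_def deletion_def)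

text \<open>A vertex of weight 0 joins the cover free of charge and meets exactly the edges that the
  deletion removed. These edges are given packing value 0, so the capacity 0 at \<open>x\<close> is
  respected.\<close>

lemma minmax_of_deletion:
  assumes simple: "simple_hypergraph H" and x: "x \<in> verts H" "c x = 0"
    and mm: "minmax (deletion x H) c"
  shows "minmax H c"
proof -
  let ?D = "deletion x H"
  have fE: "finite (edges H)" and fV: "finite (verts H)"
    using simple by (auto simp: finite_edges simple_hypergraph_def)
  obtain B y where By: "vertex_cover ?D B" "dual_feasible ?D c y" "\<forall>e\<in>edges ?D. y e \<in> \<int>"
      "real (sum c B) \<le> dual_value ?D y"
    using mm unfolding minmax_def by blast
  define y' where "y' e = (if x \<in> e then 0 else y e)" for e
  have eD: "edges ?D = {e \<in> edges H. x \<notin> e}" and vD: "verts ?D = verts H - {x}"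
    by (auto simp: deletion_def)
  have sums: "(\<Sum>e\<in>edges H. f e * y' e) = (\<Sum>e\<in>edges ?D. f e * y e)" for f
    using fE by (intro sum.mono_neutral_cong_right) (auto simp: y'_def eD)
  show ?thesis
  proof (rule minmaxI)
    show "vertex_cover H (insert x B)"
      using By(1) x(1) by (auto simp: vertex_cover_def eD vD)
    show "dual_feasible H c y'"
      unfolding dual_feasible_def
    proof (intro conjI ballI)
      fix v assume v: "v \<in> verts H"
      show "(\<Sum>e\<in>edges H. incidence v e * y' e) \<le> real (c v)"
      proof (cases "v = x")
        case True
        have "(\<Sum>e\<in>edges H. incidence v e * y' e) = 0"
          using True by (intro sum.neutral) (auto simp: y'_def incidence_def)
        then show ?thesis by simp
      next
        case False
        then show ?thesis using By(2) v unfolding sums by (auto simp: dual_feasible_def vD)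
      qed
    next
      fix e assume "e \<in> edges H"
      then show "0 \<le> y' e" using By(2) by (auto simp: y'_def dual_feasible_def eD)
    qed
    show "y' e \<in> \<int>" if "e \<in> edges H" for e using that By(3) by (auto simp: y'_def eD)
    have "x \<notin> B" "finite B" using By(1) fV by (auto simp: vertex_cover_def vD intro: finite_subset)
    then show "real (sum c (insert x B)) \<le> dual_value H y'"
      using By(4) x(2) sums[of "\<lambda>_. 1"] by (simp add: dual_value_def)
  qed
qed

text \<open>Covers stay covers when enlarged within \<open>verts H\<close>, so testing the removal
  of single vertices captures minimality under inclusion. In this form each vertex of the cover has
  an edge that no other vertex of the cover meets.\<close>

definition minimal_cover :: "'v hypergraph \<Rightarrow> 'v set \<Rightarrow> bool" where
  "minimal_cover H C \<longleftrightarrow> vertex_cover H C \<and> (\<forall>v\<in>C. \<not> vertex_cover H (C - {v}))"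

lemma minimal_cover_exists:
  assumes "finite (verts H)" "vertex_cover H B"
  shows "\<exists>C\<subseteq>B. minimal_cover H C"
proof -
  have "finite B" using assms by (auto simp: vertex_cover_def intro: finite_subset)
  then show ?thesis using assms(2)
  proof (induction B rule: finite_psubset_induct)
    case (psubset B)
    show ?case
    proof (cases "minimal_cover H B")
      case False
      then obtain v where "v \<in> B" "vertex_cover H (B - {v})"
        using psubset.prems by (auto simp: minimal_cover_def)
      then show ?thesis using psubset.IH[of "B - {v}"] by blast
    qed blast
  qed
qed

text \<open>A minimal cover inside a smallest cover cannot be smaller. Hence, once all minimal
  covers have one size, that size is \<open>cover_number H\<close>.\<close>

lemma cover_number_cover:
  assumes "simple_hypergraph H"
  shows "\<exists>C. minimal_cover H C \<and> card C = cover_number H"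
proof -
  have fV: "finite (verts H)" and sub: "\<And>e. e \<in> edges H \<Longrightarrow> e \<noteq> {} \<and> e \<subseteq> verts H"
    using assms by (auto simp: simple_hypergraph_def)
  let ?K = "{card C | C. vertex_cover H C}"
  have "?K \<subseteq> card ` Pow (verts H)" by (auto simp: vertex_cover_def)
  then have fK: "finite ?K" by (rule finite_subset) (use fV in simp)
  have "vertex_cover H (verts H)" using sub by (fastforce simp: vertex_cover_def)
  then have "?K \<noteq> {}" by blast
  then have "Min ?K \<in> ?K" using fK by (rule Min_in[rotated])
  then obtain C where C: "vertex_cover H C" "card C = cover_number H"
    by (auto simp: cover_number_def)
  have "finite C" using C fV by (auto simp: vertex_cover_def intro: finite_subset)
  obtain D where D: "D \<subseteq> C" "minimal_cover H D" using minimal_cover_exists[OF fV C(1)] by blast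
  have "cover_number H \<le> card D"
    unfolding cover_number_def using D fK by (intro Min_le) (auto simp: minimal_cover_def)
  then have "card D = cover_number H" using C card_mono[OF \<open>finite C\<close> D(1)] by simp
  then show ?thesis using D by blast
qed

lemma matching_number_matching:
  assumes "simple_hypergraph H"
  shows "\<exists>M\<subseteq>edges H. pairwise disjnt M \<and> card M = matching_number H"
proof -
  let ?K = "{card M | M. M \<subseteq> edges H \<and> pairwise disjnt M}"
  have "?K \<subseteq> card ` Pow (edges H)" by auto
  then have "finite ?K" by (rule finite_subset) (use finite_edges[OF assms] in simp)
  moreover have "card {} \<in> ?K" by (intro CollectI exI[of _ "{}"]) auto
  then have "?K \<noteq> {}" by blast
  ultimately have "Max ?K \<in> ?K" by (rule Max_in)
  then show ?thesis by (auto simp: matching_number_def)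
qed

lemma minmax_of_equicardinal_covers:
  assumes simple: "simple_hypergraph H" and nontriv: "edges H \<noteq> {}" and konig: "konig H"
    and del: "\<And>x c. x \<in> verts H \<Longrightarrow> minmax (deletion x H) c"
    and eq: "\<And>C D. minimal_cover H C \<Longrightarrow> minimal_cover H D \<Longrightarrow> card C = card D"
  shows "minmax H c"
proof -
  have fV: "finite (verts H)" and sub: "\<And>e. e \<in> edges H \<Longrightarrow> e \<noteq> {} \<and> e \<subseteq> verts H"
    using simple by (auto simp: simple_hypergraph_def)
  have fE: "finite (edges H)" using simple by (rule finite_edges)
  have cm: "cover_number H = matching_number H"
    using konig nontriv sub by (auto simp: konig_def trivial_hypergraph_def)
  obtain M where M: "M \<subseteq> edges H" "pairwise disjnt M" "card M = cover_number H"
    using matching_number_matching[OF simple] cm by auto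
  have card_cover: "card C = card M" if "minimal_cover H C" for C
    using cover_number_cover[OF simple] M(3) eq[OF that] by metis
  have fM: "finite M" using M fE finite_subset by blast
  have UV: "\<Union>M \<subseteq> verts H" using M(1) sub by blast
  \<comment> \<open>A nonempty matching makes the descent strict. If \<open>M\<close> were empty,
    the empty set would be a minimal cover, although there is an edge.\<close>
  have "M \<noteq> {}"
  proof
    assume "M = {}"
    obtain C where C: "minimal_cover H C" using cover_number_cover[OF simple] by blast
    then have "finite C" using fV by (auto simp: minimal_cover_def vertex_cover_def intro: finite_subset)
    then have "C = {}" using card_cover[OF C] \<open>M = {}\<close> by simp
    then show False using C nontriv by (auto simp: minimal_cover_def vertex_cover_def)
  qed
  then obtain u where u: "u \<in> \<Union>M" using M(1) sub by blast
  \<comment> \<open>Disjointness leaves at most one edge of \<open>M\<close> through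
    \<open>v\<close>.\<close>
  have inc: "(\<Sum>e\<in>M. incidence v e) = (of_bool (v \<in> \<Union>M) :: real)" for v
  proof (cases "v \<in> \<Union>M")
    case True
    then obtain e where e: "e \<in> M" "v \<in> e" by blast
    have "(\<Sum>e\<in>M. incidence v e) = (\<Sum>e'\<in>M. if e' = e then 1 else 0 :: real)"
      using e M(2) by (intro sum.cong) (auto simp: incidence_def pairwise_def disjnt_def)
    then show ?thesis using True e(1) fM by simp
  qed (auto simp: incidence_def intro!: sum.neutral)
  show ?thesis
  proof (induction "sum c (verts H)" arbitrary: c rule: less_induct)
    case less
    show ?case
    proof (cases "\<exists>x\<in>verts H. c x = 0")
      case True
      then show ?thesis using minmax_of_deletion[OF simple] del by blast
    next
      case False
      \<comment> \<open>Subtraction on \<open>nat\<close> truncates, but here every vertex has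
        weight at least 1, so \<open>c\<close> is recovered exactly from \<open>d\<close> on
        \<open>verts H\<close>.\<close>
      define d where "d v = c v - of_bool (v \<in> \<Union>M)" for v
      have cd: "c v = d v + of_bool (v \<in> \<Union>M)" if "v \<in> verts H" for v
        using that False by (auto simp: d_def of_bool_def Suc_leI)
      have "sum d (verts H) < sum c (verts H)"
        using fV cd u UV by (intro sum_strict_mono_ex1) (auto intro!: bexI[of _ u])
      then obtain B y where By: "vertex_cover H B" "dual_feasible H d y" "\<forall>e\<in>edges H. y e \<in> \<int>"
          "real (sum d B) \<le> dual_value H y"
        using less unfolding minmax_def by blast
      \<comment> \<open>The cover \<open>B\<close> may be larger than \<open>M\<close>. Shrinking it
        to a minimal cover does not raise its \<open>d\<close>-weight and brings its size down to
        \<open>card M\<close>.\<close>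
      obtain C where C: "C \<subseteq> B" "minimal_cover H C"
        using minimal_cover_exists[OF fV By(1)] by blast
      have BV: "B \<subseteq> verts H" and CV: "C \<subseteq> verts H" and vC: "vertex_cover H C"
        using By(1) C by (auto simp: vertex_cover_def minimal_cover_def)
      have fB: "finite B" "finite C" using BV CV fV finite_subset by blast+
      define z where "z e = y e + of_bool (e \<in> M)" for e
      have sumz: "(\<Sum>e\<in>edges H. f e * z e) = (\<Sum>e\<in>edges H. f e * y e) + sum f M" for f
      proof -
        have "(\<Sum>e\<in>edges H. f e * of_bool (e \<in> M)) = sum f M"
          using fE M(1) by (intro sum.mono_neutral_cong_right) auto
        then show ?thesis by (simp add: z_def distrib_left sum.distrib)
      qed
      show ?thesis
      proof (rule minmaxI)
        show "vertex_cover H C" by (rule vC)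
        show "dual_feasible H c z"
          unfolding dual_feasible_def sumz inc
          using By(2) cd by (auto simp: dual_feasible_def z_def)
        show "z e \<in> \<int>" if "e \<in> edges H" for e
          using that By(3) by (auto simp: z_def)
        have "sum c C = (\<Sum>v\<in>C. d v + of_bool (v \<in> \<Union>M))"
          using cd[OF subsetD[OF CV]] by (intro sum.cong refl) blast
        also have "\<dots> \<le> sum d C + card C"
          using sum_bounded_above[of C "\<lambda>v. of_bool (v \<in> \<Union>M)" "1 :: nat"]
          by (simp add: sum.distrib)
        also have "\<dots> \<le> sum d B + card M"
          using C card_cover[OF C(2)] fB by (intro add_mono sum_mono2) auto
        finally have "real (sum c C) \<le> real (sum d B) + real (card M)" by linarith
        then show "real (sum c C) \<le> dual_value H z"
          using By(4) sumz[of "\<lambda>_. 1"] by (simp add: dual_value_def)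
      qed
    qed
  qed
qed

section \<open>Primes generated by variables and their heights\<close>

abbreviation "lookup \<equiv> Poly_Mapping.lookup"
abbreviation "keys \<equiv> Poly_Mapping.keys"

text \<open>Elimination: if some coefficient \<open>A t m\<close> is nonzero, equation
  \<open>m\<close> is solved for the unknown \<open>t\<close> and substituted into the others, which
  leaves one equation and one unknown fewer. In the application the unknowns are the coefficients of
  an algebraic relation and the equations belong to monomials.\<close>

lemma homogeneous_system_solution:
  fixes A :: "'s \<Rightarrow> 'm \<Rightarrow> 'k::field"
  assumes "finite M" "finite S" "card M < card S"
  shows "\<exists>c. (\<exists>s\<in>S. c s \<noteq> 0) \<and> (\<forall>m\<in>M. (\<Sum>s\<in>S. c s * A s m) = 0)"
  using assms
proof (induction M arbitrary: S A rule: finite_induct)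
  case empty
  then have "S \<noteq> {}" by auto
  then show ?case by (intro exI[of _ "\<lambda>_. 1"]) auto
next
  case (insert m M)
  show ?case
  proof (cases "\<forall>s\<in>S. A s m = 0")
    case True
    have "card M < card S" using insert by simp
    then obtain c where "\<exists>s\<in>S. c s \<noteq> 0" "\<forall>x\<in>M. (\<Sum>s\<in>S. c s * A s x) = 0"
      using insert.IH[OF insert.prems(1), of A] by blast
    then show ?thesis using True by (intro exI[of _ c]) auto
  next
    case False
    then obtain t where t: "t \<in> S" "A t m \<noteq> 0" by blast
    let ?A = "\<lambda>s x. A s x - A s m / A t m * A t x"
    have "card M < card (S - {t})" "finite (S - {t})" using insert t by auto
    then obtain c where c: "\<exists>s\<in>S - {t}. c s \<noteq> 0"
        "\<forall>x\<in>M. (\<Sum>s\<in>S - {t}. c s * ?A s x) = 0"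
      using insert.IH[of "S - {t}" ?A] by blast
    define c' where "c' = c(t := - (\<Sum>s\<in>S - {t}. c s * (A s m / A t m)))"
    have eq: "(\<Sum>s\<in>S. c' s * A s x) = (\<Sum>s\<in>S - {t}. c s * ?A s x)" for x
    proof -
      have "(\<Sum>s\<in>S. c' s * A s x) = c' t * A t x + (\<Sum>s\<in>S - {t}. c' s * A s x)"
        using insert.prems(1) t(1) by (rule sum.remove)
      also have "(\<Sum>s\<in>S - {t}. c' s * A s x) = (\<Sum>s\<in>S - {t}. c s * A s x)"
        by (intro sum.cong) (auto simp: c'_def)
      finally show ?thesis
        by (simp add: c'_def right_diff_distrib sum_subtractf sum_distrib_right mult.assoc)
    qed
    have "(\<Sum>s\<in>S. c' s * A s x) = 0" if "x \<in> insert m M" for x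
      unfolding eq using that c(2) t(2) by auto
    moreover have "\<exists>s\<in>S. c' s \<noteq> 0" using c(1) by (auto simp: c'_def)
    ultimately show ?thesis by blast
  qed
qed

text \<open>Positional notation: with a base \<open>L\<close> above every exponent of
  \<open>x\<close> that occurs in \<open>K\<close>, the exponent of \<open>x\<close> is the last
  digit of the weight and the weight on the remaining variables is the quotient.\<close>

lemma separating_weight:
  fixes K :: "('v \<Rightarrow>\<^sub>0 nat) set"
  assumes "finite V" "finite K"
  shows "\<exists>g :: 'v \<Rightarrow> nat. \<forall>m\<in>K. \<forall>m'\<in>K.
    (\<Sum>v\<in>V. lookup m v * g v) = (\<Sum>v\<in>V. lookup m' v * g v) \<longrightarrow> (\<forall>v\<in>V. lookup m v = lookup m' v)"
  using assms(1)
proof (induction V rule: finite_induct)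
  case (insert x V)
  obtain g :: "'v \<Rightarrow> nat" where g: "\<And>m m'. m \<in> K \<Longrightarrow> m' \<in> K \<Longrightarrow>
      (\<Sum>v\<in>V. lookup m v * g v) = (\<Sum>v\<in>V. lookup m' v * g v) \<Longrightarrow> \<forall>v\<in>V. lookup m v = lookup m' v"
    using insert.IH by blast
  define L where "L = Suc (\<Sum>m\<in>K. lookup m x)"
  have L: "lookup m x < L" if "m \<in> K" for m
    using member_le_sum[OF that, of "\<lambda>m. lookup m x"] assms(2) by (simp add: L_def less_Suc_eq_le)
  define g' where "g' = (\<lambda>v. L * g v)(x := 1)"
  have eq: "(\<Sum>v\<in>insert x V. lookup m v * g' v) = lookup m x + L * (\<Sum>v\<in>V. lookup m v * g v)" for m
  proof -
    have "(\<Sum>v\<in>V. lookup m v * g' v) = L * (\<Sum>v\<in>V. lookup m v * g v)"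
      unfolding sum_distrib_left using insert.hyps by (intro sum.cong) (auto simp: g'_def)
    then show ?thesis using insert.hyps by (simp add: g'_def)
  qed
  show ?case
  proof (intro exI[of _ g'] ballI impI)
    fix m m' v
    assume m: "m \<in> K" "m' \<in> K" and v: "v \<in> insert x V"
      and e: "(\<Sum>v\<in>insert x V. lookup m v * g' v) = (\<Sum>v\<in>insert x V. lookup m' v * g' v)"
    let ?s = "\<lambda>m. \<Sum>v\<in>V. lookup m v * g v"
    have e: "lookup m x + L * ?s m = lookup m' x + L * ?s m'" using e unfolding eq .
    have "(lookup m x + L * ?s m) mod L = lookup m x" "(lookup m' x + L * ?s m') mod L = lookup m' x"
      "(lookup m x + L * ?s m) div L = ?s m" "(lookup m' x + L * ?s m') div L = ?s m'"
      using L[OF m(1)] L[OF m(2)] by auto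
    then have "lookup m x = lookup m' x" "?s m = ?s m'" using e by metis+
    then show "lookup m v = lookup m' v" using g[OF m] v by blast
  qed
qed simp

text \<open>In the convolution at \<open>a + b\<close>, a first summand other than \<open>a\<close>
  contributes only vanishing products, and cancellation of exponent vectors fixes the second summand
  once the first is \<open>a\<close>.\<close>

lemma lookup_mult_unique:
  fixes p q :: "('v \<Rightarrow>\<^sub>0 nat) \<Rightarrow>\<^sub>0 'k::semiring_0"
  assumes "\<And>a' b'. a' \<in> keys p \<Longrightarrow> b' \<in> keys q \<Longrightarrow> a' + b' = a + b \<Longrightarrow> a' = a"
  shows "lookup (p * q) (a + b) = lookup p a * lookup q b"
proof -
  have "lookup p l * (\<Sum>r. lookup q r when a + b = l + r) = (lookup p a * lookup q b when l = a)" for l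
  proof (cases "l = a")
    case False
    then have "lookup p l = 0 \<or> (\<forall>r. (lookup q r when a + b = l + r) = 0)"
      using assms[of l] by (force simp: when_def in_keys_iff)
    then show ?thesis using False by auto
  qed simp
  then show ?thesis unfolding lookup_mult by simp
qed

section \<open>Polynomial rings and their ideals generated by variables\<close>

lemma mpoly_ring_simps [simp]:
  "x \<oplus>\<^bsub>mpoly_ring V\<^esub> y = x + y" "x \<otimes>\<^bsub>mpoly_ring V\<^esub> y = x * y"
  "\<zero>\<^bsub>mpoly_ring V\<^esub> = 0" "\<one>\<^bsub>mpoly_ring V\<^esub> = 1"
  by (simp_all add: mpoly_ring_def)

lemma carrier_mpoly_ring: "carrier (mpoly_ring V) = {p. \<forall>m\<in>keys p. keys m \<subseteq> V}"
  by (simp add: mpoly_ring_def)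

lemma a_inv_mpoly_ring:
  assumes "x \<in> carrier (mpoly_ring V)"
  shows "\<ominus>\<^bsub>mpoly_ring V\<^esub> x = - x"
proof -
  interpret cring "mpoly_ring V" by (rule mpoly_ring_cring)
  have "- x \<in> carrier (mpoly_ring V)" using assms by (simp add: carrier_mpoly_ring)
  then show ?thesis using minus_equality[of "- x" x] assms by simp
qed

lemma keys_add_nat: "keys (a + b) = keys a \<union> keys (b :: 'v \<Rightarrow>\<^sub>0 nat)"
  by (auto simp: in_keys_iff lookup_add)

text \<open>The ideal generated by the variables in \<open>C\<close>, described through the monomials of its elements.\<close>

definition var_prime :: "'v set \<Rightarrow> 'v set \<Rightarrow> ('v, 'k::field) mpoly set" where
  "var_prime V C = {p \<in> carrier (mpoly_ring V). \<forall>m\<in>keys p. keys m \<inter> C \<noteq> {}}"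

lemma ideal_var_prime: "ideal (var_prime V C :: ('v, 'k::field) mpoly set) (mpoly_ring V)"
proof -
  let ?R = "mpoly_ring V :: ('v, 'k) mpoly ring"
  interpret cring ?R by (rule mpoly_ring_cring)
  have mult: "x * a \<in> var_prime V C" if "a \<in> var_prime V C" "x \<in> carrier ?R" for a x
  proof -
    have "x \<otimes>\<^bsub>?R\<^esub> a \<in> carrier ?R" using that by (intro m_closed) (auto simp: var_prime_def)
    moreover have "keys m \<inter> C \<noteq> {}" if m: "m \<in> keys (x * a)" for m
    proof -
      obtain b b' where "b' \<in> keys a" "m = b + b'" using subsetD[OF keys_mult m] by blast
      moreover have "keys b' \<inter> C \<noteq> {}"
        using \<open>a \<in> var_prime V C\<close> \<open>b' \<in> keys a\<close> by (simp add: var_prime_def)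
      ultimately show ?thesis by (auto simp: keys_add_nat)
    qed
    ultimately show ?thesis by (simp add: var_prime_def)
  qed
  show ?thesis
  proof (rule idealI)
    show "subgroup (var_prime V C) (add_monoid ?R)"
    proof
      show "var_prime V C \<subseteq> carrier (add_monoid ?R)" by (auto simp: var_prime_def)
    next
      fix x y :: "('v, 'k) mpoly" assume xy: "x \<in> var_prime V C" "y \<in> var_prime V C"
      have "x \<oplus>\<^bsub>?R\<^esub> y \<in> carrier ?R" using xy by (intro a_closed) (auto simp: var_prime_def)
      then show "x \<otimes>\<^bsub>add_monoid ?R\<^esub> y \<in> var_prime V C"
        using xy keys_add[of x y] by (fastforce simp: var_prime_def)
    next
      show "\<one>\<^bsub>add_monoid ?R\<^esub> \<in> var_prime V C" by (simp add: var_prime_def carrier_mpoly_ring)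
    next
      fix x :: "('v, 'k) mpoly" assume x: "x \<in> var_prime V C"
      then have "inv\<^bsub>add_monoid ?R\<^esub> x = - x"
        using a_inv_mpoly_ring[of x V] by (simp add: a_inv_def var_prime_def)
      then show "inv\<^bsub>add_monoid ?R\<^esub> x \<in> var_prime V C"
        using x by (simp add: var_prime_def carrier_mpoly_ring)
    qed
  qed (use mult in \<open>auto simp: mult.commute ring_axioms\<close>)
qed

text \<open>The product of the heaviest monomials of \<open>p\<close> and \<open>q\<close> avoiding \<open>C\<close>, with respect to an additive
  weight that separates the monomials of \<open>p\<close>, cannot cancel in \<open>p * q\<close>.\<close>

lemma primeideal_var_prime:
  assumes "finite V"
  shows "primeideal (var_prime V C :: ('v, 'k::field) mpoly set) (mpoly_ring V)"
proof (rule primeidealI)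
  let ?R = "mpoly_ring V :: ('v, 'k) mpoly ring"
  show "ideal (var_prime V C) ?R" by (rule ideal_var_prime)
  show "cring ?R" by (rule mpoly_ring_cring)
  have "(1 :: ('v, 'k) mpoly) \<in> carrier ?R" by (simp add: carrier_mpoly_ring)
  moreover have "(1 :: ('v, 'k) mpoly) \<notin> var_prime V C" by (simp add: var_prime_def)
  ultimately show "carrier ?R \<noteq> var_prime V C" by metis
next
  fix p q :: "('v, 'k) mpoly"
  assume p: "p \<in> carrier (mpoly_ring V)" and q: "q \<in> carrier (mpoly_ring V)"
    and pq: "p \<otimes>\<^bsub>mpoly_ring V\<^esub> q \<in> var_prime V C"
  define K where "K r = {m \<in> keys r. keys m \<inter> C = {}}" for r :: "('v, 'k) mpoly"
  have fK: "finite (K r)" for r by (simp add: K_def)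
  show "p \<in> var_prime V C \<or> q \<in> var_prime V C"
  proof (rule ccontr)
    assume "\<not> ?thesis"
    then have ne: "K p \<noteq> {}" "K q \<noteq> {}" using p q by (auto simp: var_prime_def K_def)
    obtain g :: "'v \<Rightarrow> nat" where g: "\<And>m m'. m \<in> keys p \<Longrightarrow> m' \<in> keys p \<Longrightarrow>
        (\<Sum>v\<in>V. lookup m v * g v) = (\<Sum>v\<in>V. lookup m' v * g v) \<Longrightarrow> \<forall>v\<in>V. lookup m v = lookup m' v"
      using separating_weight[OF assms finite_keys[of p]] by blast
    define w where "w m = (\<Sum>v\<in>V. lookup m v * g v)" for m
    have w_add: "w (m + m') = w m + w m'" for m m'
      by (simp add: w_def lookup_add distrib_right sum.distrib)
    have inj: "m = m'" if "m \<in> keys p" "m' \<in> keys p" "w m = w m'" for m m'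
    proof (rule poly_mapping_eqI)
      fix v
      have sub: "keys m \<subseteq> V" "keys m' \<subseteq> V" using p that by (simp_all add: carrier_mpoly_ring)
      show "lookup m v = lookup m' v"
      proof (cases "v \<in> V")
        case True
        then show ?thesis using g[OF that(1,2)] that(3) unfolding w_def by blast
      next
        case False
        then have "v \<notin> keys m" "v \<notin> keys m'" using sub by blast+
        then show ?thesis by (simp add: in_keys_iff)
      qed
    qed
    have mx: "\<exists>m\<in>K r. \<forall>m'\<in>K r. w m' \<le> w m" if "K r \<noteq> {}" for r
    proof -
      have "Max (w ` K r) \<in> w ` K r" using fK that by (intro Max_in) auto
      then obtain m where "m \<in> K r" "Max (w ` K r) = w m" by auto
      then show ?thesis using Max_ge[of "w ` K r"] fK by (metis finite_imageI imageI)
    qed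
    obtain a where a: "a \<in> K p" "\<forall>m'\<in>K p. w m' \<le> w a" using mx[OF ne(1)] by blast
    obtain b where b: "b \<in> K q" "\<forall>m'\<in>K q. w m' \<le> w b" using mx[OF ne(2)] by blast
    have "lookup (p * q) (a + b) = lookup p a * lookup q b"
    proof (rule lookup_mult_unique)
      fix a' b' assume ab: "a' \<in> keys p" "b' \<in> keys q" "a' + b' = a + b"
      \<comment> \<open>The summands of a monomial avoiding \<open>C\<close> avoid \<open>C\<close>
        too, so \<open>a'\<close> and \<open>b'\<close> compete with \<open>a\<close> and
        \<open>b\<close> and weigh no more. Equal total weight then forces equal weights, and the
        weight separates the monomials of \<open>p\<close>.\<close>
      have "keys a' \<union> keys b' = keys a \<union> keys b" using ab(3) by (metis keys_add_nat)
      moreover have "(keys a \<union> keys b) \<inter> C = {}" using a(1) b(1) by (auto simp: K_def)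
      ultimately have "(keys a' \<union> keys b') \<inter> C = {}" by simp
      then have "a' \<in> K p" "b' \<in> K q" using ab(1,2) by (auto simp: K_def)
      then have "w a' \<le> w a" "w b' \<le> w b" using a b by auto
      moreover have "w a' + w b' = w a + w b" using ab(3) by (metis w_add)
      ultimately have "w a' = w a" by linarith
      then show "a' = a" using inj ab(1) a(1) by (auto simp: K_def)
    qed
    then have "a + b \<in> keys (p * q)" using a(1) b(1) by (auto simp: K_def in_keys_iff)
    then have "keys (a + b) \<inter> C \<noteq> {}" using pq by (simp add: var_prime_def)
    then show False using a(1) b(1) by (auto simp: K_def keys_add_nat)
  qed
qed

lemma Var_in_carrier: "v \<in> V \<Longrightarrow> (Var v :: ('v, 'k::field) mpoly) \<in> carrier (mpoly_ring V)"
  by (simp add: Var_def carrier_mpoly_ring)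

lemma Var_in_var_prime_iff:
  "v \<in> V \<Longrightarrow> (Var v :: ('v, 'k::field) mpoly) \<in> var_prime V C \<longleftrightarrow> v \<in> C"
  by (auto simp: Var_def var_prime_def carrier_mpoly_ring)

lemma var_prime_strict_mono:
  assumes "C \<subset> D" "D \<subseteq> V"
  shows "(var_prime V C :: ('v, 'k::field) mpoly set) \<subset> var_prime V D"
proof -
  obtain v where v: "v \<in> D" "v \<notin> C" "v \<in> V" using assms by blast
  have "(var_prime V C :: ('v, 'k) mpoly set) \<subseteq> var_prime V D"
    using assms by (fastforce simp: var_prime_def)
  moreover have "(Var v :: ('v, 'k) mpoly) \<in> var_prime V D" "(Var v :: ('v, 'k) mpoly) \<notin> var_prime V C"
    using v by (simp_all add: Var_in_var_prime_iff)
  ultimately show ?thesis by blast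
qed

lemma prod_Var:
  assumes "finite e"
  shows "\<exists>m. (\<Prod>v\<in>e. Var v :: ('v, 'k::field) mpoly) = Poly_Mapping.single m 1 \<and>
    (\<forall>v. lookup m v = of_bool (v \<in> e))"
  using assms
proof (induction e rule: finite_induct)
  case empty
  show ?case by (intro exI[of _ 0]) auto
next
  case (insert x e)
  then obtain m where m: "(\<Prod>v\<in>e. Var v :: ('v, 'k) mpoly) = Poly_Mapping.single m 1"
      "\<forall>v. lookup m v = of_bool (v \<in> e)"
    by blast
  show ?case
    using insert m
    by (intro exI[of _ "Poly_Mapping.single x 1 + m"])
      (auto simp: Var_def mult_single lookup_add lookup_single when_def)
qed

section \<open>Prime chains, algebraic dependence and heights\<close>

lemma primeideal_mpolyD:
  assumes "primeideal P (mpoly_ring V :: ('v, 'k::field) mpoly ring)"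
  shows primeideal_carrier: "\<And>x. x \<in> P \<Longrightarrow> x \<in> carrier (mpoly_ring V)"
    and primeideal_diff: "\<And>x y. x \<in> P \<Longrightarrow> y \<in> P \<Longrightarrow> x - y \<in> P"
    and primeideal_mult: "\<And>x y. x \<in> P \<Longrightarrow> y \<in> carrier (mpoly_ring V) \<Longrightarrow> x * y \<in> P"
    and primeideal_prime: "\<And>x y. x \<in> carrier (mpoly_ring V) \<Longrightarrow> y \<in> carrier (mpoly_ring V) \<Longrightarrow>
      x * y \<in> P \<Longrightarrow> x \<in> P \<or> y \<in> P"
    and primeideal_one: "1 \<notin> P"
    and primeideal_zero: "0 \<in> P"
proof -
  interpret primeideal P "mpoly_ring V :: ('v, 'k) mpoly ring" by (rule assms)
  show carr: "x \<in> carrier (mpoly_ring V)" if "x \<in> P" for x using that by (rule a_Hcarr)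
  have add: "x + y \<in> P" if "x \<in> P" "y \<in> P" for x y
    using additive_subgroup.a_closed[OF is_additive_subgroup that] by simp
  show mult: "x * y \<in> P" if "x \<in> P" "y \<in> carrier (mpoly_ring V)" for x y
    using I_r_closed[OF that] by simp
  show "x - y \<in> P" if xy: "x \<in> P" "y \<in> P" for x y
  proof -
    have "- y \<in> P"
      using additive_subgroup.a_inv_closed[OF is_additive_subgroup xy(2)] carr[OF xy(2)]
      by (simp add: a_inv_mpoly_ring)
    then show ?thesis using add[OF xy(1), of "- y"] by simp
  qed
  show "x \<in> P \<or> y \<in> P" if "x \<in> carrier (mpoly_ring V)" "y \<in> carrier (mpoly_ring V)" "x * y \<in> P" for x y
    using I_prime[OF that(1,2)] that(3) by simp
  show "1 \<notin> P" using one_imp_carrier I_notcarr by auto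
  show "0 \<in> P" using zero_closed additive_subgroup.zero_closed[OF is_additive_subgroup] by simp
qed

lemma carrier_mpoly_mult:
  "x \<in> carrier (mpoly_ring V) \<Longrightarrow> y \<in> carrier (mpoly_ring V) \<Longrightarrow>
    (x * y :: ('v, 'k::field) mpoly) \<in> carrier (mpoly_ring V)"
  using cring.cring_simprules(5)[OF mpoly_ring_cring, of x V y] by simp

lemma carrier_mpoly_add:
  "x \<in> carrier (mpoly_ring V) \<Longrightarrow> y \<in> carrier (mpoly_ring V) \<Longrightarrow>
    (x + y :: ('v, 'k::field) mpoly) \<in> carrier (mpoly_ring V)"
  using cring.cring_simprules(1)[OF mpoly_ring_cring, of x V y] by simp

lemma carrier_mpoly_zero_one [simp]: "0 \<in> carrier (mpoly_ring V)" "1 \<in> carrier (mpoly_ring V)"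
  by (simp_all add: carrier_mpoly_ring)

lemma carrier_mpoly_single_zero:
  "(Poly_Mapping.single 0 c :: ('v, 'k::field) mpoly) \<in> carrier (mpoly_ring V)"
  by (simp add: carrier_mpoly_ring)

lemma carrier_mpoly_power:
  "x \<in> carrier (mpoly_ring V) \<Longrightarrow> (x ^ n :: ('v, 'k::field) mpoly) \<in> carrier (mpoly_ring V)"
  by (induction n) (auto intro: carrier_mpoly_mult)

lemma carrier_mpoly_prod:
  "(\<And>i. i \<in> I \<Longrightarrow> f i \<in> carrier (mpoly_ring V)) \<Longrightarrow>
    ((\<Prod>i\<in>I. f i) :: ('v, 'k::field) mpoly) \<in> carrier (mpoly_ring V)"
  by (induction I rule: infinite_finite_induct)
    (auto intro: carrier_mpoly_mult)

lemma carrier_mpoly_sum: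
  "(\<And>i. i \<in> I \<Longrightarrow> f i \<in> carrier (mpoly_ring V)) \<Longrightarrow>
    ((\<Sum>i\<in>I. f i) :: ('v, 'k::field) mpoly) \<in> carrier (mpoly_ring V)"
  by (induction I rule: infinite_finite_induct)
    (auto intro: carrier_mpoly_add)

text \<open>The sum is factored as \<open>a\<^sub>j\<^sup>\<mu> (T + a\<^sub>j R)\<close>, where \<open>\<mu>\<close> is the least exponent of \<open>a\<^sub>j\<close>; since \<open>a\<^sub>j\<close> lies in
  \<open>Q (j + 1)\<close> but not in the prime \<open>Q j\<close>, this puts \<open>T\<close> into \<open>Q (j + 1)\<close>.\<close>

lemma prime_chain_no_relation:
  fixes a :: "nat \<Rightarrow> ('v, 'k::field) mpoly" and c :: "(nat \<Rightarrow> nat) \<Rightarrow> 'k"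
  assumes prime: "\<And>i. i \<le> r \<Longrightarrow> primeideal (Q i) (mpoly_ring V)"
    and mono: "\<And>i. i < r \<Longrightarrow> Q i \<subseteq> Q (Suc i)"
    and a: "\<And>i. i < r \<Longrightarrow> a i \<in> Q (Suc i) - Q i"
    and "j \<le> r" "finite S" "S \<noteq> {}" "\<And>\<alpha>. \<alpha> \<in> S \<Longrightarrow> c \<alpha> \<noteq> 0"
    and "\<And>\<alpha> \<beta>. \<alpha> \<in> S \<Longrightarrow> \<beta> \<in> S \<Longrightarrow> (\<And>i. i \<in> {j..<r} \<Longrightarrow> \<alpha> i = \<beta> i) \<Longrightarrow> \<alpha> = \<beta>"
  shows "(\<Sum>\<alpha>\<in>S. Poly_Mapping.single 0 (c \<alpha>) * (\<Prod>i\<in>{j..<r}. a i ^ \<alpha> i)) \<notin> Q j"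
  using assms(4-)
proof (induction j arbitrary: S rule: inc_induct)
  case base
  \<comment> \<open>With no factors left all exponent tuples agree vacuously, so \<open>S\<close> is
    a singleton and the sum is a nonzero constant, hence a unit.\<close>
  obtain \<alpha> where \<alpha>: "\<alpha> \<in> S" using base by blast
  have "\<beta> = \<alpha>" if "\<beta> \<in> S" for \<beta> using base(4)[OF that \<alpha>] by simp
  then have S: "S = {\<alpha>}" using \<alpha> by blast
  show ?case
  proof
    assume "(\<Sum>\<alpha>\<in>S. Poly_Mapping.single 0 (c \<alpha>) * (\<Prod>i\<in>{r..<r}. a i ^ \<alpha> i)) \<in> Q r"
    then have "Poly_Mapping.single 0 (c \<alpha>) \<in> Q r" by (simp add: S)
    then have "Poly_Mapping.single 0 (c \<alpha>) * Poly_Mapping.single 0 (inverse (c \<alpha>)) \<in> Q r"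
      using primeideal_mult[OF prime[OF order_refl]] carrier_mpoly_single_zero by blast
    moreover have "Poly_Mapping.single 0 (c \<alpha>) * Poly_Mapping.single 0 (inverse (c \<alpha>)) = (1 :: ('v, 'k) mpoly)"
      using base(3)[OF \<alpha>] by (simp add: mult_single)
    ultimately show False using primeideal_one[OF prime[OF order_refl]] by simp
  qed
next
  case (step j)
  have pj: "primeideal (Q j) (mpoly_ring V)" and pj1: "primeideal (Q (Suc j)) (mpoly_ring V)"
    using prime step.hyps by auto
  have aj: "a j \<in> Q (Suc j)" "a j \<notin> Q j" using a step.hyps by auto
  have ac: "a i \<in> carrier (mpoly_ring V)" if "i < r" for i
    using primeideal_carrier[OF prime[of "Suc i"]] a[OF that] that by auto
  have ajc: "a j \<in> carrier (mpoly_ring V)" using ac step.hyps by blast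
  define \<mu> where "\<mu> = Min ((\<lambda>\<alpha>. \<alpha> j) ` S)"
  have \<mu>: "\<mu> \<le> \<alpha> j" if "\<alpha> \<in> S" for \<alpha>
    using that step.prems(1) by (simp add: \<mu>_def)
  have "\<mu> \<in> (\<lambda>\<alpha>. \<alpha> j) ` S" unfolding \<mu>_def using step.prems by (intro Min_in) auto
  define S' where "S' = {\<alpha> \<in> S. \<alpha> j = \<mu>}"
  have S': "S' \<subseteq> S" "S' \<noteq> {}" using \<open>\<mu> \<in> _\<close> by (auto simp: S'_def)
  define f where "f \<alpha> = Poly_Mapping.single 0 (c \<alpha>) * (\<Prod>i\<in>{Suc j..<r}. a i ^ \<alpha> i)" for \<alpha>
  have fc: "f \<alpha> \<in> carrier (mpoly_ring V)" for \<alpha>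
    unfolding f_def using ac
    by (intro carrier_mpoly_mult carrier_mpoly_prod carrier_mpoly_power carrier_mpoly_single_zero) auto
  define T where "T = sum f S'"
  \<comment> \<open>Outside \<open>S'\<close> the exponent of \<open>a j\<close> exceeds
    \<open>\<mu>\<close>, so one more factor \<open>a j\<close> can be split off after
    \<open>a j ^ \<mu>\<close>. The \<open>- 1\<close> accounts for it, and this factor puts
    \<open>a j * R\<close> into \<open>Q (Suc j)\<close>.\<close>
  define R where "R = (\<Sum>\<alpha>\<in>S - S'. a j ^ (\<alpha> j - \<mu> - 1) * f \<alpha>)"
  have Tc: "T \<in> carrier (mpoly_ring V)" unfolding T_def by (intro carrier_mpoly_sum fc)
  have Rc: "R \<in> carrier (mpoly_ring V)" unfolding R_def
    by (intro carrier_mpoly_sum carrier_mpoly_mult carrier_mpoly_power fc ajc)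
  have TR: "T + a j * R \<in> carrier (mpoly_ring V)"
    by (intro carrier_mpoly_add carrier_mpoly_mult Tc Rc ajc)
  have Tnot: "T \<notin> Q (Suc j)"
    unfolding T_def f_def
  proof (rule step.IH)
    show "finite S'" using step.prems(1) S'(1) by (rule finite_subset[rotated])
    show "S' \<noteq> {}" by (rule S'(2))
    show "c \<alpha> \<noteq> 0" if "\<alpha> \<in> S'" for \<alpha> using subsetD[OF S'(1) that] by (rule step.prems(3))
  next
    fix \<alpha> \<beta> assume ab: "\<alpha> \<in> S'" "\<beta> \<in> S'" and eq: "\<And>i. i \<in> {Suc j..<r} \<Longrightarrow> \<alpha> i = \<beta> i"
    \<comment> \<open>Members of \<open>S'\<close> share the exponent \<open>\<mu>\<close> at
      \<open>j\<close>, so agreement beyond \<open>j\<close> is already agreement from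
      \<open>j\<close> on.\<close>
    show "\<alpha> = \<beta>"
    proof (rule step.prems(4)[OF subsetD[OF S'(1) ab(1)] subsetD[OF S'(1) ab(2)]])
      fix i assume "i \<in> {j..<r}"
      then show "\<alpha> i = \<beta> i" using ab eq[of i] by (cases "i = j") (auto simp: S'_def)
    qed
  qed
  have split: "{j..<r} = insert j {Suc j..<r}" using step.hyps by auto
  have "(\<Sum>\<alpha>\<in>S. Poly_Mapping.single 0 (c \<alpha>) * (\<Prod>i\<in>{j..<r}. a i ^ \<alpha> i)) = (\<Sum>\<alpha>\<in>S. a j ^ \<alpha> j * f \<alpha>)"
    unfolding split f_def by (simp add: mult_ac)
  also have "\<dots> = (\<Sum>\<alpha>\<in>S'. a j ^ \<alpha> j * f \<alpha>) + (\<Sum>\<alpha>\<in>S - S'. a j ^ \<alpha> j * f \<alpha>)"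
    unfolding sum.subset_diff[OF S'(1) step.prems(1)] by (rule add.commute)
  also have "(\<Sum>\<alpha>\<in>S'. a j ^ \<alpha> j * f \<alpha>) = a j ^ \<mu> * T"
    unfolding T_def sum_distrib_left by (intro sum.cong) (auto simp: S'_def)
  also have "(\<Sum>\<alpha>\<in>S - S'. a j ^ \<alpha> j * f \<alpha>) = a j ^ \<mu> * (a j * R)"
    unfolding R_def sum_distrib_left
  proof (intro sum.cong refl)
    fix \<alpha> assume "\<alpha> \<in> S - S'"
    then have "\<mu> < \<alpha> j" using \<mu>[of \<alpha>] by (auto simp: S'_def)
    then have "a j ^ \<alpha> j = a j ^ (\<mu> + Suc (\<alpha> j - \<mu> - 1))" by simp
    then show "a j ^ \<alpha> j * f \<alpha> = a j ^ \<mu> * (a j * (a j ^ (\<alpha> j - \<mu> - 1) * f \<alpha>))"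
      by (simp only: power_add power_Suc mult.assoc)
  qed
  finally have eq: "(\<Sum>\<alpha>\<in>S. Poly_Mapping.single 0 (c \<alpha>) * (\<Prod>i\<in>{j..<r}. a i ^ \<alpha> i)) = a j ^ \<mu> * (T + a j * R)"
    by (simp add: distrib_left)
  have pow: "a j ^ n \<notin> Q j" for n
  proof (induction n)
    case (Suc n)
    then show ?case
      using primeideal_prime[OF pj ajc carrier_mpoly_power[OF ajc], of n] aj(2) by auto
  qed (use primeideal_one[OF pj] in simp)
  have "T + a j * R \<notin> Q j"
  proof
    assume "T + a j * R \<in> Q j"
    then have "T + a j * R \<in> Q (Suc j)" using mono[of j] step.hyps by auto
    then have "T + a j * R - a j * R \<in> Q (Suc j)"
      using primeideal_diff[OF pj1] primeideal_mult[OF pj1 aj(1) Rc] by blast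
    then show False using Tnot by simp
  qed
  then show ?case
    unfolding eq using primeideal_prime[OF pj carrier_mpoly_power[OF ajc] TR, of \<mu>] pow[of \<mu>] by blast
qed

text \<open>Bounding each exponent separately, rather than the total degree, keeps the count of
  monomials a plain power and makes the bounds add up under products.\<close>

definition exp_box :: "'v set \<Rightarrow> nat \<Rightarrow> ('v \<Rightarrow>\<^sub>0 nat) set" where
  "exp_box V b = {m. keys m \<subseteq> V \<and> (\<forall>v. lookup m v \<le> b)}"

lemma exp_box_finite_card:
  assumes "finite V"
  shows "finite (exp_box V b) \<and> card (exp_box V b) \<le> Suc b ^ card V"
proof -
  let ?f = "\<lambda>m. restrict (lookup m) V" and ?P = "PiE V (\<lambda>_. {..b})"
  have inj: "inj_on ?f (exp_box V b)"
  proof (rule inj_onI, rule poly_mapping_eqI)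
    fix m m' v assume m: "m \<in> exp_box V b" "m' \<in> exp_box V b" and eq: "?f m = ?f m'"
    show "lookup m v = lookup m' v"
    proof (cases "v \<in> V")
      case True
      then show ?thesis using fun_cong[OF eq, of v] by simp
    next
      case False
      then have "v \<notin> keys m" "v \<notin> keys m'" using m by (auto simp: exp_box_def)
      then show ?thesis by (simp add: in_keys_iff)
    qed
  qed
  have img: "?f ` exp_box V b \<subseteq> ?P" by (auto simp: exp_box_def)
  have fP: "finite ?P" using assms by (intro finite_PiE) auto
  have "card ?P = Suc b ^ card V" using assms by (simp add: card_PiE)
  then show ?thesis
    using inj img fP card_inj_on_le[OF inj img fP] inj_on_finite[OF inj img fP] by simp
qed

lemma exp_box_mult:
  fixes p q :: "('v, 'k::field) mpoly"
  assumes "keys p \<subseteq> exp_box V b" "keys q \<subseteq> exp_box V b'"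
  shows "keys (p * q) \<subseteq> exp_box V (b + b')"
proof
  fix m assume "m \<in> keys (p * q)"
  then obtain x y where "x \<in> keys p" "y \<in> keys q" "m = x + y" using keys_mult[of p q] by blast
  then show "m \<in> exp_box V (b + b')"
    using assms by (fastforce simp: exp_box_def keys_add_nat lookup_add intro: add_mono)
qed

lemma exp_box_power:
  fixes p :: "('v, 'k::field) mpoly"
  assumes "keys p \<subseteq> exp_box V b"
  shows "keys (p ^ n) \<subseteq> exp_box V (n * b)"
proof (induction n)
  case (Suc n)
  then show ?case using exp_box_mult[OF assms Suc] by simp
qed (simp add: exp_box_def)

lemma exp_box_prod:
  fixes f :: "'i \<Rightarrow> ('v, 'k::field) mpoly"
  assumes "\<And>i. i \<in> I \<Longrightarrow> keys (f i) \<subseteq> exp_box V b"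
  shows "keys (\<Prod>i\<in>I. f i) \<subseteq> exp_box V (card I * b)"
  using assms
proof (induction I rule: infinite_finite_induct)
  case (insert i I)
  then show ?case using exp_box_mult[of "f i" V b "prod f I" "card I * b"] by simp
qed (simp_all add: exp_box_def)

lemma lookup_single_zero_mult:
  fixes p :: "('v, 'k::field) mpoly"
  shows "lookup (Poly_Mapping.single 0 c * p) m = c * lookup p m"
  using lookup_mult_unique[of "Poly_Mapping.single 0 c" p 0 m] by (cases "c = 0") auto

text \<open>For large \<open>N\<close> there are more products of the \<open>a i\<close> with exponents at most \<open>N\<close> than there are
  monomials in which they can be expanded.\<close>

lemma algebraic_dependence:
  fixes a :: "nat \<Rightarrow> ('v, 'k::field) mpoly"
  assumes V: "finite V" and r: "r > card V"
    and a: "\<forall>i<r. a i \<in> carrier (mpoly_ring V)"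
  shows "\<exists>S c. finite S \<and> S \<noteq> {} \<and> S \<subseteq> extensional {..<r} \<and> (\<forall>\<alpha>\<in>S. c \<alpha> \<noteq> (0 :: 'k)) \<and>
    (\<Sum>\<alpha>\<in>S. Poly_Mapping.single 0 (c \<alpha>) * (\<Prod>i<r. a i ^ \<alpha> i)) = 0"
proof -
  define D where "D = (\<Sum>i<r. \<Sum>m\<in>keys (a i). \<Sum>v\<in>V. lookup m v)"
  have box: "keys (a i) \<subseteq> exp_box V D" if i: "i < r" for i
  proof
    fix m assume m: "m \<in> keys (a i)"
    have mV: "keys m \<subseteq> V" using a i m by (auto simp: carrier_mpoly_ring)
    have "lookup m v \<le> D" for v
    proof (cases "v \<in> V")
      case True
      have "lookup m v \<le> (\<Sum>v\<in>V. lookup m v)" using True V by (intro member_le_sum) auto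
      also have "\<dots> \<le> (\<Sum>m\<in>keys (a i). \<Sum>v\<in>V. lookup m v)" using m by (intro member_le_sum) auto
      also have "\<dots> \<le> D" unfolding D_def using i by (intro member_le_sum) auto
      finally show ?thesis .
    next
      case False
      then have "lookup m v = 0" using mV by (auto simp: in_keys_iff subset_iff)
      then show ?thesis by simp
    qed
    then show "m \<in> exp_box V D" using mV by (simp add: exp_box_def)
  qed
  \<comment> \<open>With these choices \<open>Suc b \<le> E * Suc N\<close>, so the number of
    monomials is at most \<open>E ^ card V * Suc N ^ card V\<close>. As \<open>N\<close> equals the
    first factor, this is below \<open>Suc N ^ Suc (card V)\<close>, hence below the number of
    exponent tuples.\<close>
  define E where "E = Suc (r * D)"
  define N where "N = E ^ card V"
  define b where "b = r * (N * D)"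
  \<comment> \<open>As members of \<open>PiE\<close>, tuples that agree below \<open>r\<close> are
    equal as functions; prime chains need exponent tuples separated in this way.\<close>
  define S0 where "S0 = PiE {..<r} (\<lambda>_. {..N})"
  have fS0: "finite S0" unfolding S0_def by (intro finite_PiE) auto
  have cS0: "card S0 = Suc N ^ r" by (simp add: S0_def card_PiE)
  have mon: "keys (\<Prod>i<r. a i ^ \<alpha> i) \<subseteq> exp_box V b" if \<alpha>: "\<alpha> \<in> S0" for \<alpha>
  proof -
    have "keys (a i ^ \<alpha> i) \<subseteq> exp_box V (N * D)" if "i \<in> {..<r}" for i
    proof -
      have "\<alpha> i \<le> N" using \<alpha> that by (auto simp: S0_def)
      then have "exp_box V (\<alpha> i * D) \<subseteq> exp_box V (N * D)"
        by (fastforce simp: exp_box_def intro: order_trans mult_right_mono)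
      then show ?thesis using exp_box_power[OF box, of i "\<alpha> i"] that by auto
    qed
    then show ?thesis using exp_box_prod[of "{..<r}" "\<lambda>i. a i ^ \<alpha> i" V "N * D"] by (simp add: b_def)
  qed
  have "Suc b \<le> E * Suc N" by (simp add: b_def E_def algebra_simps)
  have "card (exp_box V b) \<le> Suc b ^ card V" using exp_box_finite_card[OF V] by blast
  also have "\<dots> \<le> (E * Suc N) ^ card V" using \<open>Suc b \<le> _\<close> by (intro power_mono) auto
  also have "\<dots> = N * Suc N ^ card V" unfolding power_mult_distrib by (simp only: N_def)
  also have "\<dots> < Suc N ^ Suc (card V)" by simp
  also have "\<dots> \<le> Suc N ^ r" using r by (intro power_increasing) auto
  finally have "card (exp_box V b) < card S0" by (simp add: cS0)
  then obtain c :: "(nat \<Rightarrow> nat) \<Rightarrow> 'k" where c: "\<exists>\<alpha>\<in>S0. c \<alpha> \<noteq> 0"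
      "\<And>m. m \<in> exp_box V b \<Longrightarrow> (\<Sum>\<alpha>\<in>S0. c \<alpha> * lookup (\<Prod>i<r. a i ^ \<alpha> i) m) = 0"
    using homogeneous_system_solution[of "exp_box V b" S0 "\<lambda>\<alpha> m. lookup (\<Prod>i<r. a i ^ \<alpha> i) m"]
      exp_box_finite_card[OF V] fS0 by blast
  define S where "S = {\<alpha> \<in> S0. c \<alpha> \<noteq> 0}"
  have "(\<Sum>\<alpha>\<in>S. Poly_Mapping.single 0 (c \<alpha>) * (\<Prod>i<r. a i ^ \<alpha> i)) = 0"
  proof (rule poly_mapping_eqI)
    fix m
    have "(\<Sum>\<alpha>\<in>S. c \<alpha> * lookup (\<Prod>i<r. a i ^ \<alpha> i) m) = (\<Sum>\<alpha>\<in>S0. c \<alpha> * lookup (\<Prod>i<r. a i ^ \<alpha> i) m)"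
      using fS0 by (intro sum.mono_neutral_left) (auto simp: S_def)
    also have "\<dots> = 0"
    proof (cases "m \<in> exp_box V b")
      case False
      then have "lookup (\<Prod>i<r. a i ^ \<alpha> i) m = 0" if "\<alpha> \<in> S0" for \<alpha>
        using mon[OF that] by (auto simp: in_keys_iff subset_iff)
      then show ?thesis by simp
    qed (rule c(2))
    finally show "lookup (\<Sum>\<alpha>\<in>S. Poly_Mapping.single 0 (c \<alpha>) * (\<Prod>i<r. a i ^ \<alpha> i)) m = lookup 0 m"
      by (simp add: lookup_sum lookup_single_zero_mult)
  qed
  moreover have "finite S" using fS0 by (simp add: S_def)
  moreover have "S \<noteq> {}" using c(1) by (auto simp: S_def)
  moreover have "S \<subseteq> extensional {..<r}" "\<forall>\<alpha>\<in>S. c \<alpha> \<noteq> 0" by (auto simp: S_def S0_def PiE_def)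
  ultimately show ?thesis by (intro exI[of _ S] exI[of _ c] conjI)
qed

text \<open>One element is taken from each gap of the chain. If there are more than
  \<open>card V\<close> of them, they satisfy a nontrivial relation, whose left-hand side is 0 and
  so lies in \<open>Q 0\<close>; a prime chain forbids exactly this.\<close>

lemma prime_chain_length:
  fixes Q :: "nat \<Rightarrow> ('v, 'k::field) mpoly set"
  assumes V: "finite V" and prime: "\<And>i. i \<le> n \<Longrightarrow> primeideal (Q i) (mpoly_ring V)"
    and strict: "\<And>i. i < n \<Longrightarrow> Q i \<subset> Q (Suc i)"
  shows "n \<le> card V"
proof (rule ccontr)
  assume n: "\<not> n \<le> card V"
  define a where "a i = (SOME x. x \<in> Q (Suc i) - Q i)" for i
  have a: "a i \<in> Q (Suc i) - Q i" if "i < n" for i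
  proof -
    have "\<exists>x. x \<in> Q (Suc i) - Q i" using strict[OF that] by blast
    then show ?thesis unfolding a_def by (rule someI_ex)
  qed
  have ac: "\<forall>i<n. a i \<in> carrier (mpoly_ring V)"
    using primeideal_carrier[OF prime] a by (meson DiffD1 Suc_leI)
  have "card V < n" using n by simp
  obtain S and c :: "(nat \<Rightarrow> nat) \<Rightarrow> 'k" where S: "finite S" "S \<noteq> {}" "S \<subseteq> extensional {..<n}"
      "\<forall>\<alpha>\<in>S. c \<alpha> \<noteq> 0"
    and rel: "(\<Sum>\<alpha>\<in>S. Poly_Mapping.single 0 (c \<alpha>) * (\<Prod>i<n. a i ^ \<alpha> i)) = 0"
    using algebraic_dependence[OF V \<open>card V < n\<close> ac] by (elim exE conjE) (rule that)
  have "(\<Sum>\<alpha>\<in>S. Poly_Mapping.single 0 (c \<alpha>) * (\<Prod>i\<in>{0..<n}. a i ^ \<alpha> i)) \<notin> Q 0"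
  proof (rule prime_chain_no_relation[where r = n and j = 0 and Q = Q and a = a and c = c and V = V and S = S])
    fix \<alpha> \<beta> assume "\<alpha> \<in> S" "\<beta> \<in> S" and eq: "\<And>i. i \<in> {0..<n} \<Longrightarrow> \<alpha> i = \<beta> i"
    then have "\<alpha> \<in> extensional {..<n}" "\<beta> \<in> extensional {..<n}" using S(3) by blast+
    then show "\<alpha> = \<beta>" by (rule extensionalityI) (rule eq, simp)
  next
    show "Q i \<subseteq> Q (Suc i)" if "i < n" for i using strict[OF that] by blast
  next
    show "c \<alpha> \<noteq> 0" if "\<alpha> \<in> S" for \<alpha> using S(4) that by blast
  next
    show "primeideal (Q i) (mpoly_ring V)" if "i \<le> n" for i using that by (rule prime)
  next
    show "a i \<in> Q (Suc i) - Q i" if "i < n" for i using that by (rule a)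
  qed (use S(1,2) in simp_all)
  then show False using rel primeideal_zero[OF prime[of 0]] by (simp add: lessThan_atLeast0)
qed

text \<open>Upper bound: a chain ending at the prime of \<open>C\<close> extends by \<open>card (V - C)\<close> steps to the prime of
  \<open>V\<close>, so \<open>prime_chain_length\<close> applies to the longer chain.\<close>

lemma height_var_prime:
  assumes V: "finite V" and C: "C \<subseteq> V"
  shows "prime_height (mpoly_ring V) (var_prime V C :: ('v, 'k::field) mpoly set) = enat (card C)"
proof -
  let ?R = "mpoly_ring V :: ('v, 'k) mpoly ring"
  let ?P = "var_prime V :: 'v set \<Rightarrow> ('v, 'k) mpoly set"
  let ?chain = "\<lambda>n Q. (\<forall>i\<le>n. primeideal (Q i) ?R) \<and> (\<forall>i<n. Q i \<subset> Q (Suc i)) \<and> Q n = ?P C"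
  \<comment> \<open>Adjoins variables one at a time: with \<open>B = C\<close> it climbs from the
    given prime to that of \<open>V\<close>, with \<open>B = {}\<close> up to the prime of
    \<open>C\<close>.\<close>
  have steps: "?P (B \<union> f ` {0..<i}) \<subset> ?P (B \<union> f ` {0..<Suc i})"
    if f: "bij_betw f {0..<k} D" and D: "D \<subseteq> V - B" and i: "i < k" and B: "B \<subseteq> V" for f i k B D
  proof (rule var_prime_strict_mono)
    have fi: "f i \<in> D" using bij_betwE[OF f] i by simp
    have "f i \<notin> f ` {0..<i}"
      using inj_on_image_mem_iff[OF bij_betw_imp_inj_on[OF f], of i "{0..<i}"] i by simp
    moreover have "f i \<notin> B" using fi D by blast
    ultimately show "B \<union> f ` {0..<i} \<subset> B \<union> f ` {0..<Suc i}"
      by (auto simp: atLeast0_lessThan_Suc)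
    have "f ` {0..<Suc i} \<subseteq> f ` {0..<k}" using i by (intro image_mono) auto
    then show "B \<union> f ` {0..<Suc i} \<subseteq> V"
      using bij_betw_imp_surj_on[OF f] D B by blast
  qed
  have prime: "primeideal (?P B) ?R" for B using V by (rule primeideal_var_prime)
  have fC: "finite C" using V C finite_subset by blast
  show ?thesis
  proof (rule antisym)
    show "prime_height ?R (?P C) \<le> enat (card C)"
      unfolding prime_height_def
    proof (rule Sup_least)
      fix h assume "h \<in> {enat n | n. \<exists>Q. ?chain n Q}"
      then obtain n Q where h: "h = enat n" and Q: "?chain n Q" by blast
      obtain f where f: "bij_betw f {0..<card (V - C)} (V - C)"
        using V ex_bij_betw_nat_finite[of "V - C"] by auto
      define Q' where "Q' i = (if i \<le> n then Q i else ?P (C \<union> f ` {0..<i - n}))" for i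
      \<comment> \<open>At \<open>i = n\<close> no variable has been adjoined yet and
        \<open>Q n\<close> is the prime of \<open>C\<close>, so both clauses agree where the two
        chains are glued.\<close>
      have Q'2: "Q' i = ?P (C \<union> f ` {0..<i - n})" if "i \<ge> n" for i
        using that Q by (auto simp: Q'_def)
      have "n + card (V - C) \<le> card V"
      proof (rule prime_chain_length[OF V, where Q = Q'])
        show "primeideal (Q' i) ?R" for i
          using Q prime unfolding Q'_def by (cases "i \<le> n") (simp_all only: if_True if_False)
        show "Q' i \<subset> Q' (Suc i)" if "i < n + card (V - C)" for i
        proof (cases "i < n")
          case True
          then show ?thesis using Q by (simp add: Q'_def)
        next
          case False
          then have "Q' i = ?P (C \<union> f ` {0..<i - n})"
            "Q' (Suc i) = ?P (C \<union> f ` {0..<Suc (i - n)})"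
            using Q'2[of i] Q'2[of "Suc i"] by (simp_all only: Suc_diff_le not_less le_Suc_eq simp_thms)
          moreover have "i - n < card (V - C)" using that False by simp
          ultimately show ?thesis using steps[OF f subset_refl _ C] by metis
        qed
      qed
      then show "h \<le> enat (card C)"
        using h V C card_mono[OF V C] by (simp add: card_Diff_subset[OF fC C])
    qed
    obtain f where f: "bij_betw f {0..<card C} C" using fC ex_bij_betw_nat_finite by blast
    have "?chain (card C) (\<lambda>i. ?P (f ` {0..<i}))"
    proof (intro conjI allI impI)
      show "?P (f ` {0..<i}) \<subset> ?P (f ` {0..<Suc i})" if "i < card C" for i
        using steps[OF f _ that, of "{}"] C by simp
      show "?P (f ` {0..<card C}) = ?P C" unfolding bij_betw_imp_surj_on[OF f] ..
    qed (rule prime)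
    then have "\<exists>Q. ?chain (card C) Q"
      by (rule exI[of _ "\<lambda>i. ?P (f ` {0..<i})"])
    then have "enat (card C) \<in> {enat n | n. \<exists>Q. ?chain n Q}"
      by (intro CollectI exI[of _ "card C"] conjI refl)
    then show "enat (card C) \<le> prime_height ?R (?P C)"
      unfolding prime_height_def by (rule Sup_upper)
  qed
qed

section \<open>Associated primes of the edge ideal\<close>

text \<open>Each term of \<open>p\<close> is a multiple of the squarefree generator of an edge
  contained in its support, and \<open>p\<close> is the finite sum of its terms.\<close>

lemma mem_edge_ideal:
  assumes simple: "simple_hypergraph H"
    and p: "p \<in> carrier (mpoly_ring (verts H))"
    and div: "\<And>m. m \<in> keys p \<Longrightarrow> \<exists>e\<in>edges H. e \<subseteq> keys m"
  shows "p \<in> (edge_ideal H :: ('v, 'k::field) mpoly set)"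
proof -
  let ?R = "mpoly_ring (verts H) :: ('v, 'k) mpoly ring" and ?I = "edge_ideal H :: ('v, 'k) mpoly set"
  let ?G = "(\<lambda>e. \<Prod>v\<in>e. Var v :: ('v, 'k) mpoly) ` edges H"
  interpret cring ?R by (rule mpoly_ring_cring)
  have G: "?G \<subseteq> carrier ?R"
    using simple by (auto simp: simple_hypergraph_def intro!: carrier_mpoly_prod Var_in_carrier)
  interpret ideal ?I ?R unfolding edge_ideal_def using G by (rule genideal_ideal)
  have monomial_mem: "Poly_Mapping.single m (lookup p m) \<in> ?I" if m: "m \<in> keys p" for m
  proof -
    obtain e where e: "e \<in> edges H" "e \<subseteq> keys m" using div[OF m] by blast
    then have "finite e" by (simp add: finite_subset)
    then obtain me where me: "(\<Prod>v\<in>e. Var v :: ('v, 'k) mpoly) = Poly_Mapping.single me 1"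
        "\<forall>v. lookup me v = of_bool (v \<in> e)"
      using prod_Var by blast
    \<comment> \<open>Subtraction of exponents truncates but is exact here: the generator has
      exponent 1 on \<open>e\<close>, where \<open>m\<close> has at least 1, and 0
      elsewhere.\<close>
    have "m = (m - me) + me"
    proof (rule poly_mapping_eqI)
      fix v
      have "lookup me v \<le> lookup m v"
        using e(2) me(2) by (cases "v \<in> e") (auto simp: in_keys_iff Suc_le_eq)
      then show "lookup m v = lookup (m - me + me) v" by (simp add: lookup_add lookup_minus)
    qed
    then have eq: "Poly_Mapping.single m (lookup p m) =
        Poly_Mapping.single (m - me) (lookup p m) * (\<Prod>v\<in>e. Var v)"
      by (simp add: me(1) mult_single)
    have "keys (m - me) \<subseteq> keys m" by (auto simp: in_keys_iff lookup_minus)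
    then have "Poly_Mapping.single (m - me) (lookup p m) \<in> carrier ?R"
      using p m by (auto simp: carrier_mpoly_ring)
    moreover have "(\<Prod>v\<in>e. Var v) \<in> ?I"
      unfolding edge_ideal_def using genideal_self[OF G] e(1) by blast
    ultimately show ?thesis unfolding eq using I_l_closed[of "\<Prod>v\<in>e. Var v"] by simp
  qed
  have "(\<Sum>m\<in>K. Poly_Mapping.single m (lookup p m)) \<in> ?I" if "finite K" "K \<subseteq> keys p" for K
    using that
  proof (induction K rule: finite_induct)
    case empty
    then show ?case using additive_subgroup.zero_closed[OF is_additive_subgroup] by simp
  next
    case (insert m K)
    then show ?case
      using additive_subgroup.a_closed[OF is_additive_subgroup monomial_mem, of m] by simp
  qed
  from this[of "keys p"] have "(\<Sum>m\<in>keys p. Poly_Mapping.single m (lookup p m)) \<in> ?I" by simp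
  moreover have "(\<Sum>m\<in>keys p. Poly_Mapping.single m (lookup p m)) = p"
    by (rule poly_mapping_eqI)
      (auto simp: lookup_sum lookup_single when_def in_keys_iff)
  ultimately show ?thesis by simp
qed

lemma monomial_in_var_prime_iff:
  "(Poly_Mapping.single m 1 :: ('v, 'k::field) mpoly) \<in> var_prime V C \<longleftrightarrow> keys m \<subseteq> V \<and> keys m \<inter> C \<noteq> {}"
  by (simp add: var_prime_def carrier_mpoly_ring)

lemma var_primeD:
  assumes "p \<in> var_prime V C"
  shows "p \<in> carrier (mpoly_ring V)" "\<And>m. m \<in> keys p \<Longrightarrow> keys m \<inter> C \<noteq> {}"
  using assms by (simp_all add: var_prime_def)

text \<open>The prime is the colon ideal of \<open>f\<close>, the product of all variables outside
  \<open>C\<close>. That \<open>f\<close> multiplies the prime into the edge ideal rests on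
  minimality of \<open>C\<close>; the converse holds because the edge ideal lies in the prime while
  \<open>f\<close> does not.\<close>

lemma assoc_prime_minimal_cover:
  assumes simple: "simple_hypergraph H" and C: "minimal_cover H C"
  shows "(var_prime (verts H) C :: ('v, 'k::field) mpoly set)
    \<in> assoc_primes (mpoly_ring (verts H)) (edge_ideal H)"
proof -
  let ?V = "verts H"
  let ?R = "mpoly_ring ?V :: ('v, 'k) mpoly ring"
  let ?P = "var_prime ?V C :: ('v, 'k) mpoly set" and ?I = "edge_ideal H :: ('v, 'k) mpoly set"
  have fV: "finite ?V" and sub: "\<And>e. e \<in> edges H \<Longrightarrow> e \<subseteq> ?V"
    using simple by (auto simp: simple_hypergraph_def)
  interpret P: primeideal ?P ?R using fV by (rule primeideal_var_prime)
  have vC: "vertex_cover H C" using C by (simp add: minimal_cover_def)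
  then have CV: "C \<subseteq> ?V" and cov: "\<And>e. e \<in> edges H \<Longrightarrow> C \<inter> e \<noteq> {}"
    by (simp_all add: vertex_cover_def)
  define f :: "('v, 'k) mpoly" where "f = (\<Prod>v\<in>?V - C. Var v)"
  obtain mf where mf: "f = Poly_Mapping.single mf 1" "\<forall>v. lookup mf v = of_bool (v \<in> ?V - C)"
    using prod_Var[of "?V - C", where 'k = 'k] fV unfolding f_def by auto
  have kf: "keys mf = ?V - C" by (rule Set.set_eqI) (simp add: in_keys_iff mf(2))
  have fc: "f \<in> carrier ?R" unfolding f_def by (intro carrier_mpoly_prod Var_in_carrier) auto
  have fP: "f \<notin> ?P" unfolding mf(1) monomial_in_var_prime_iff kf by blast
  have IP: "?I \<subseteq> ?P"
    unfolding edge_ideal_def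
  proof (rule P.genideal_minimal[OF P.ideal_axioms])
    show "(\<lambda>e. \<Prod>v\<in>e. Var v) ` edges H \<subseteq> ?P"
    proof clarify
      fix e assume e: "e \<in> edges H"
      then have "finite e" using sub fV finite_subset by blast
      then obtain me where me: "(\<Prod>v\<in>e. Var v :: ('v, 'k) mpoly) = Poly_Mapping.single me 1"
          "\<forall>v. lookup me v = of_bool (v \<in> e)"
        using prod_Var by blast
      have "keys me = e" by (rule Set.set_eqI) (simp add: in_keys_iff me(2))
      then show "(\<Prod>v\<in>e. Var v) \<in> ?P"
        using cov[OF e] sub[OF e] unfolding me(1) monomial_in_var_prime_iff by blast
    qed
  qed
  have "?P = {g \<in> carrier ?R. g \<otimes>\<^bsub>?R\<^esub> f \<in> ?I}"
  proof (intro subset_antisym subsetI CollectI conjI)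
    fix g assume g: "g \<in> ?P"
    then show gc: "g \<in> carrier ?R" by (rule var_primeD)
    show "g \<otimes>\<^bsub>?R\<^esub> f \<in> ?I"
    proof (rule mem_edge_ideal[OF simple])
      show "g \<otimes>\<^bsub>?R\<^esub> f \<in> carrier ?R" using gc fc by (rule P.m_closed)
      fix m assume "m \<in> keys (g \<otimes>\<^bsub>?R\<^esub> f)"
      then have "m \<in> keys (g * f)" by simp
      then obtain m' m'' where "m' \<in> keys g" "m'' \<in> keys f" "m = m' + m''"
        using keys_mult[of g f] by blast
      moreover have "keys f = {mf}" by (simp add: mf(1))
      ultimately have m': "m' \<in> keys g" "m = m' + mf" by simp_all
      then have "keys m' \<inter> C \<noteq> {}" using var_primeD(2)[OF g] by blast
      then obtain v where v: "v \<in> C" "v \<in> keys m'" by blast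
      \<comment> \<open>Some edge meets \<open>C\<close> in \<open>v\<close> only. Its other
        vertices lie in the support of \<open>f\<close>, and \<open>v\<close> divides the monomial
        of \<open>g\<close>, so the edge is contained in the support of \<open>m\<close>.\<close>
      have "\<not> vertex_cover H (C - {v})" using C v by (simp add: minimal_cover_def)
      then obtain e where e: "e \<in> edges H" "(C - {v}) \<inter> e = {}"
        using CV unfolding vertex_cover_def by blast
      then have "e \<subseteq> keys m" unfolding m'(2) keys_add_nat kf using v(2) sub[OF e(1)] by blast
      then show "\<exists>e\<in>edges H. e \<subseteq> keys m" using e(1) by blast
    qed
  next
    fix g assume "g \<in> {g \<in> carrier ?R. g \<otimes>\<^bsub>?R\<^esub> f \<in> ?I}"
    then have "g \<in> carrier ?R" "g \<otimes>\<^bsub>?R\<^esub> f \<in> ?P" using IP by blast+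
    then show "g \<in> ?P" using P.I_prime[OF _ fc] fP by blast
  qed
  then show ?thesis
    unfolding assoc_primes_def by (intro CollectI conjI bexI[of _ f] P.primeideal_axioms fc)
qed

theorem corollary3p10:
  fixes H :: "'v hypergraph"
  assumes "simple_hypergraph H"
    and "packing H"
    and "\<not> mfmc H"
    and "\<forall>H'. is_proper_minor H' H \<longrightarrow> \<not> (packing H' \<and> \<not> mfmc H')"
  shows "\<not> unmixed (mpoly_ring (verts H)) (edge_ideal H :: ('v, 'k::field) mpoly set)"
proof
  assume unm: "unmixed (mpoly_ring (verts H)) (edge_ideal H :: ('v, 'k) mpoly set)"
  have fV: "finite (verts H)" using assms(1) by (simp add: simple_hypergraph_def)
  have eq: "card C = card D" if "minimal_cover H C" "minimal_cover H D" for C D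
  proof -
    have "C \<subseteq> verts H" "D \<subseteq> verts H" using that by (auto simp: minimal_cover_def vertex_cover_def)
    moreover have "prime_height (mpoly_ring (verts H)) (var_prime (verts H) C :: ('v, 'k) mpoly set)
        = prime_height (mpoly_ring (verts H)) (var_prime (verts H) D :: ('v, 'k) mpoly set)"
      using unm that assoc_prime_minimal_cover[OF assms(1)] unfolding unmixed_def by blast
    ultimately show ?thesis using height_var_prime[OF fV, where 'k = 'k] by (metis enat.inject)
  qed
  have "edges H \<noteq> {}" using assms(3) by (auto simp: mfmc_def trivial_hypergraph_def)
  have "konig H" using assms(2) by (auto simp: packing_def is_minor_def)
  have "minmax (deletion x H) c" if "x \<in> verts H" for x c
  proof -
    \<comment> \<open>Minors of a deletion are minors of \<open>H\<close>, so packing is inherited.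
      The deletion is a proper minor and hence no counterexample itself.\<close>
    have step: "minor_step H (deletion x H)" using that by (auto simp: minor_step_def)
    then have "packing (deletion x H)"
      using assms(2) unfolding packing_def is_minor_def by (meson converse_rtranclp_into_rtranclp)
    then have "mfmc (deletion x H)"
      using assms(4) step by (auto simp: is_proper_minor_def)
    then show ?thesis using mfmc_imp_minmax[OF simple_deletion[OF assms(1)]] by blast
  qed
  then have "minmax H c" for c
    using minmax_of_equicardinal_covers[OF assms(1) \<open>edges H \<noteq> {}\<close> \<open>konig H\<close>] eq by blast
  then show False using minmax_imp_mfmc[OF assms(1)] assms(3) by blast
qed

end
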